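(* Let $1<p,q<\infty$ with $q\neq2$. Then there exists a Calderón–Zygmund operator $T$ on $\mathbb{R}^n$ which is not bounded on $M^{p,q}(\mathbb{R}^n)$, i.e. there is no constant $C$ with $\|Tf\|_{M^{p,q}}\le C\|f\|_{M^{p,q}}$ for all $f\in\mathcal{S}(\mathbb{R}^n)$.
   Context: A Calderón–Zygmund operator is an $L^2(\mathbb{R}^n)$-bounded linear operator whose distributional kernel coincides, outside the diagonal $\{x=y\}$, with a function $K(x,y)$ satisfying, for some $0<\epsilon\le1$ and $C>0$: $|K(x,y)|\le C|x-y|^{-n}$; $|K(x,y)-K(x',y)|\le C|x-x'|^\epsilon|x-y|^{-n-\epsilon}$ for $|x-y|>2|x-x'|$; $|K(x,y)-K(x,y')|\le C|y-y'|^\epsilon|x-y|^{-n-\epsilon}$ for $|x-y|>2|y-y'|$. Modulation spaces: fix a window $\gamma\in\mathcal{S}(\mathbb{R}^n)\setminus\{0\}$, set $V_\gamma f(x,\xi)=(f,M_\xi T_x\gamma)$ with $M_\xi\gamma(t)=e^{i\xi\cdot t}\gamma(t)$, $T_x\gamma(t)=\gamma(t-x)$; $M^{p,q}(\mathbb{R}^n)$ is the set of $f\in\mathcal{S}'(\mathbb{R}^n)$ with $\|f\|_{M^{p,q}}=\|(\int|V_\gamma f(x,\xi)|^pdx)^{1/p}\|_{L^q_\xi}<\infty$. *)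

theory Defs
  imports "HOL-Analysis.Analysis"
begin

fun pderivs :: "'n::finite list \<Rightarrow> (real^'n \<Rightarrow> complex) \<Rightarrow> real^'n \<Rightarrow> complex" where
  "pderivs [] f = f"
| "pderivs (i # is) f =
     (\<lambda>x. vector_derivative (\<lambda>t. pderivs is f (x + t *\<^sub>R axis i 1)) (at 0))"

definition schwartz :: "(real^'n::finite \<Rightarrow> complex) \<Rightarrow> bool" where
  "schwartz f \<longleftrightarrow>
     (\<forall>is i x. (\<lambda>t. pderivs is f (x + t *\<^sub>R axis i 1)) differentiable (at 0)) \<and>
     (\<forall>is (k::nat). bounded (range (\<lambda>x. norm x ^ k * norm (pderivs is f x))))"

definition tsupp :: "(real^'n::finite \<Rightarrow> complex) \<Rightarrow> (real^'n) set" where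
  "tsupp f = closure {x. f x \<noteq> 0}"

definition test_fun :: "(real^'n::finite \<Rightarrow> complex) \<Rightarrow> bool" where
  "test_fun f \<longleftrightarrow> schwartz f \<and> compact (tsupp f)"

definition sq_int :: "(real^'n::finite \<Rightarrow> complex) \<Rightarrow> bool" where
  "sq_int f \<longleftrightarrow> f \<in> borel_measurable lborel \<and> integrable lborel (\<lambda>x. (norm (f x))\<^sup>2)"

definition L2norm :: "(real^'n::finite \<Rightarrow> complex) \<Rightarrow> real" where
  "L2norm f = sqrt (LINT x|lborel. (norm (f x))\<^sup>2)"

definition CZO :: "((real^'n::finite \<Rightarrow> complex) \<Rightarrow> (real^'n \<Rightarrow> complex)) \<Rightarrow>
                   (real^'n \<Rightarrow> real^'n \<Rightarrow> complex) \<Rightarrow> bool" where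
  "CZO T K \<longleftrightarrow>
     \<comment> \<open>linear on L^2 (a.e.)\<close>
     (\<forall>f g a b. sq_int f \<longrightarrow> sq_int g \<longrightarrow>
        (AE x in lborel. T (\<lambda>y. a * f y + b * g y) x = a * T f x + b * T g x)) \<and>
     \<comment> \<open>bounded on L^2\<close>
     (\<exists>C. \<forall>f. sq_int f \<longrightarrow> sq_int (T f) \<and> L2norm (T f) \<le> C * L2norm f) \<and>
     \<comment> \<open>kernel representation off the diagonal\<close>
     (\<lambda>(x, y). K x y) \<in> borel_measurable (lborel \<Otimes>\<^sub>M lborel) \<and>
     (\<forall>\<phi> \<psi>. test_fun \<phi> \<longrightarrow> test_fun \<psi> \<longrightarrow> tsupp \<phi> \<inter> tsupp \<psi> = {} \<longrightarrow>
        (LINT x|lborel. T \<phi> x * \<psi> x) = (LINT x|lborel. LINT y|lborel. K x y * \<phi> y * \<psi> x)) \<and>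
     \<comment> \<open>standard kernel estimates\<close>
     (\<exists>eps C. 0 < eps \<and> eps \<le> 1 \<and> 0 < C \<and>
        (\<forall>x y. x \<noteq> y \<longrightarrow> norm (K x y) \<le> C * norm (x - y) powr (- real CARD('n))) \<and>
        (\<forall>x x' y. x \<noteq> y \<longrightarrow> norm (x - y) > 2 * norm (x - x') \<longrightarrow>
           norm (K x y - K x' y) \<le> C * norm (x - x') powr eps * norm (x - y) powr (- real CARD('n) - eps)) \<and>
        (\<forall>x y y'. x \<noteq> y \<longrightarrow> norm (x - y) > 2 * norm (y - y') \<longrightarrow>
           norm (K x y - K x y') \<le> C * norm (y - y') powr eps * norm (x - y) powr (- real CARD('n) - eps)))"

definition stft :: "(real^'n::finite \<Rightarrow> complex) \<Rightarrow> (real^'n \<Rightarrow> complex) \<Rightarrow> real^'n \<Rightarrow> real^'n \<Rightarrow> complex" where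
  "stft \<gamma> f x \<xi> = (LINT t|lborel. f t * cnj (cis (\<xi> \<bullet> t) * \<gamma> (t - x)))"

text \<open>Power of an extended nonnegative real with positive real exponent (infinity stays infinity).\<close>
definition ennpow :: "ennreal \<Rightarrow> real \<Rightarrow> ennreal" where
  "ennpow a r = (if a = top then top else ennreal (enn2real a powr r))"

definition mod_norm :: "real \<Rightarrow> real \<Rightarrow> (real^'n::finite \<Rightarrow> complex) \<Rightarrow> (real^'n \<Rightarrow> complex) \<Rightarrow> ennreal" where
  "mod_norm p q \<gamma> f =
     ennpow (\<integral>\<^sup>+ \<xi>. ennpow (\<integral>\<^sup>+ x. ennreal (norm (stft \<gamma> f x \<xi>) powr p) \<partial>lborel) (q / p) \<partial>lborel) (1 / q)"

end

theory Submission
  imports Defs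
begin

text \<open>
  Multiplication by a bounded function \<open>m\<close> is a Calderon--Zygmund operator whose kernel vanishes off
  the diagonal, so it suffices that some bounded \<open>m\<close> is not a multiplier of the modulation space.
  Let \<open>P\<close> be a Rudin--Shapiro polynomial of length \<open>N\<close> with widely spaced frequencies, divided by
  \<open>sqrt (2 * N)\<close>, so that \<open>norm P \<le> 1\<close>. The short-time Fourier transform of \<open>P * \<gamma>\<close> consists of
  \<open>N\<close> almost disjoint frequency translates of that of \<open>\<gamma>\<close>, so the norm of \<open>P * \<gamma>\<close> is comparable to
  \<open>N powr (1 / q - 1 / 2)\<close>. For \<open>q < 2\<close> this is unbounded, and \<open>P\<close> is applied to \<open>\<gamma>\<close>. For \<open>q > 2\<close>
  it tends to \<open>0\<close>, and \<open>cnj P\<close> is applied to \<open>P * \<gamma>\<close>, because \<open>cnj P * P * \<gamma>\<close> retains the component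
  \<open>\<gamma> / 2\<close> at frequency zero. A single \<open>m\<close> containing far-away copies of all these multipliers
  inherits all their lower bounds, by translation invariance and Fatou's lemma.
\<close>

section \<open>Mixed norms\<close>

text \<open>For a sum of modulations of \<gamma> the exponent p acts in the variable x, where all
  terms are concentrated in the same way as \<gamma>, so up to constants only the l^q size of the
  coefficients is seen. A pointwise bound on a multiplier, however, controls its coefficients in
  l^2. Rudin-Shapiro signs make the clash as sharp as possible: all coefficients have the same
  modulus, while the sup norm exceeds their l^2 norm by at most the factor sqrt 2. The obstacle is
  uniformity: the constants in the comparison must not depend on N. The spacing R is therefore
  chosen after N, so that the other frequencies, whose tails add up to a multiple of N / R, stay
  below half of the main term. What remains concerns \<gamma> alone:
  \<open>stft \<gamma> \<gamma>\<close> decays rapidly in both variables, by integration by parts,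
  and it is bounded away from zero near the origin, where its value is the integral of the squared
  modulus of \<gamma>. In addition the test inputs, which are modulated sums and translates, have to
  be shown to be Schwartz functions.\<close>

lemma ennpow_ennreal: "0 \<le> a \<Longrightarrow> ennpow (ennreal a) r = ennreal (a powr r)"
  by (simp add: ennpow_def)

lemma ennpow_ennpow_inverse:
  assumes "0 < r" shows "ennpow (ennpow a (1 / r)) r = a"
  using assms by (cases a) (auto simp: ennpow_def powr_powr)

lemma ennpow_less_iff:
  assumes "0 < r" shows "ennpow a r < ennpow b r \<longleftrightarrow> a < b"
proof (cases a)
  case (real s)
  show ?thesis
  proof (cases b)
    case (real u)
    have "s powr r < u powr r \<longleftrightarrow> s < u"
      using assms \<open>0 \<le> s\<close> \<open>0 \<le> u\<close>
      by (meson linorder_not_less powr_less_mono2 powr_mono2 less_imp_le)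
    then show ?thesis
      using \<open>a = ennreal s\<close> \<open>0 \<le> s\<close> real by (simp add: ennpow_ennreal ennreal_less_iff)
  qed (use real in \<open>simp add: ennpow_def\<close>)
qed (simp add: ennpow_def)

lemma ennpow_mono: "0 < r \<Longrightarrow> a \<le> b \<Longrightarrow> ennpow a r \<le> ennpow b r"
  using ennpow_less_iff[of r b a] by (simp add: linorder_not_less[symmetric])

lemma ennpow_mult:
  assumes "0 < r" shows "ennpow (a * b) r = ennpow a r * ennpow b r"
proof (cases a)
  case (real s)
  show ?thesis
  proof (cases b)
    case (real u)
    with \<open>a = ennreal s\<close> \<open>0 \<le> s\<close> show ?thesis
      by (simp add: ennpow_ennreal powr_mult ennreal_mult[symmetric])
  next
    case top
    show ?thesis
    proof (cases "s = 0")
      case True then show ?thesis using \<open>a = ennreal s\<close> by (simp add: ennpow_def)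
    next
      case False then show ?thesis
        using \<open>a = ennreal s\<close> \<open>0 \<le> s\<close> top by (simp add: ennpow_def ennreal_mult_top)
    qed
  qed
next
  case top
  show ?thesis
  proof (cases "b = 0")
    case True then show ?thesis using top by (simp add: ennpow_def)
  next
    case False
    then have "ennpow b r \<noteq> 0"
      using ennpow_less_iff[OF assms, of 0 b] by (auto simp: ennpow_def zero_less_iff_neq_zero)
    then show ?thesis using top False by (simp add: ennpow_def ennreal_top_mult)
  qed
qed

text \<open>For positive r, \<open>ennpow\<close> is a strictly increasing bijection of the extended
  half line. A level y below the power of the liminf therefore pulls back to a level that the
  sequence eventually exceeds.\<close>

lemma ennpow_liminf_le:
  fixes a :: "nat \<Rightarrow> ennreal"
  assumes "0 < r" shows "ennpow (liminf a) r \<le> liminf (\<lambda>j. ennpow (a j) r)"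
  unfolding le_Liminf_iff
proof (intro allI impI)
  fix y assume y: "y < ennpow (liminf a) r"
  have e: "y = ennpow (ennpow y (1 / r)) r"
    using ennpow_ennpow_inverse[OF assms] by simp
  then have "ennpow y (1 / r) < liminf a"
    using y ennpow_less_iff[OF assms] by metis
  then have "\<forall>\<^sub>F j in sequentially. ennpow y (1 / r) < a j"
    by (rule less_LiminfD)
  then show "\<forall>\<^sub>F j in sequentially. y < ennpow (a j) r"
    by (rule eventually_mono) (metis e ennpow_less_iff[OF assms])
qed

lemma measurable_ennpow [measurable]: "(\<lambda>a. ennpow a r) \<in> borel_measurable borel"
  unfolding ennpow_def by measurable

text \<open>The q-th power of the modulation norm. Postponing the outer root keeps the estimates
  additive over disjoint sets of frequencies.\<close>

definition mixed :: "real \<Rightarrow> real \<Rightarrow> (real^'n::finite \<Rightarrow> real^'n \<Rightarrow> complex) \<Rightarrow> ennreal" where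
  "mixed p q V = (\<integral>\<^sup>+ \<xi>. ennpow (\<integral>\<^sup>+ x. ennreal (norm (V x \<xi>) powr p) \<partial>lborel) (q / p) \<partial>lborel)"

lemma mod_norm_eq_mixed: "mod_norm p q \<gamma> f = ennpow (mixed p q (stft \<gamma> f)) (1 / q)"
  by (simp add: mod_norm_def mixed_def)

lemma mixed_le_of_mod_norm_le:
  assumes "0 < q" "mod_norm p q \<gamma> f \<le> ennreal C * mod_norm p q \<gamma> g"
  shows "mixed p q (stft \<gamma> f) \<le> ennreal (max 0 C powr q) * mixed p q (stft \<gamma> g)"
proof -
  \<comment> \<open>\<open>ennreal\<close> sends negative reals to 0, so C can be replaced by its
    positive part, which has a meaningful real power.\<close>
  have "ennreal C = ennreal (max 0 C)" by (simp add: max_def ennreal_neg)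
  then have "ennpow (mod_norm p q \<gamma> f) q \<le> ennpow (ennreal (max 0 C) * mod_norm p q \<gamma> g) q"
    using assms by (intro ennpow_mono) auto
  then show ?thesis
    using assms(1)
    by (simp only: ennpow_mult mod_norm_eq_mixed ennpow_ennpow_inverse ennpow_ennreal[OF max.cobounded1])
qed

text \<open>Fatou's lemma is applied twice, to the integral in x and then to the integral in \<xi>,
  with \<open>ennpow_liminf_le\<close> carrying the liminf through the power in between.\<close>

lemma mixed_fatou:
  fixes V :: "real^'n::finite \<Rightarrow> real^'n \<Rightarrow> complex"
  assumes pq: "0 < p" "0 < q"
    and meas: "\<And>j. (\<lambda>(\<xi>, x). W j x \<xi>) \<in> borel_measurable (lborel \<Otimes>\<^sub>M lborel)"
    and lim: "\<And>x \<xi>. (\<lambda>j. W j x \<xi>) \<longlonglongrightarrow> V x \<xi>"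
  shows "mixed p q V \<le> liminf (\<lambda>j. mixed p q (W j))"
proof -
  note meas[measurable]
  have lim': "ennreal (norm (V x \<xi>) powr p) = liminf (\<lambda>j. ennreal (norm (W j x \<xi>) powr p))" for x \<xi>
  proof -
    have "(\<lambda>j. norm (W j x \<xi>) powr p) \<longlonglongrightarrow> norm (V x \<xi>) powr p"
      using lim[of x \<xi>] pq by (intro tendsto_powr2 tendsto_norm tendsto_const) auto
    then have "(\<lambda>j. ennreal (norm (W j x \<xi>) powr p)) \<longlonglongrightarrow> ennreal (norm (V x \<xi>) powr p)"
      by (rule tendsto_ennrealI)
    then show ?thesis
      by (metis lim_imp_Liminf trivial_limit_sequentially)
  qed
  have mW: "(\<lambda>x. ennreal (norm (W j x \<xi>) powr p)) \<in> borel_measurable lborel" for j \<xi>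
    using measurable_Pair2[OF meas[of j], of \<xi>] by simp measurable
  have "mixed p q V \<le> (\<integral>\<^sup>+ \<xi>. ennpow (liminf (\<lambda>j. \<integral>\<^sup>+ x. ennreal (norm (W j x \<xi>) powr p) \<partial>lborel)) (q / p) \<partial>lborel)"
    unfolding mixed_def lim' using pq
    by (intro nn_integral_mono ennpow_mono nn_integral_liminf mW) auto
  also have "\<dots> \<le> (\<integral>\<^sup>+ \<xi>. liminf (\<lambda>j. ennpow (\<integral>\<^sup>+ x. ennreal (norm (W j x \<xi>) powr p) \<partial>lborel) (q / p)) \<partial>lborel)"
    using pq by (intro nn_integral_mono ennpow_liminf_le) auto
  also have "\<dots> \<le> liminf (\<lambda>j. mixed p q (W j))"
    unfolding mixed_def by (intro nn_integral_liminf) measurable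
  finally show ?thesis .
qed

section \<open>Translation invariance of the mixed norm\<close>

lemma nn_integral_lborel_translate:
  fixes f :: "'a::euclidean_space \<Rightarrow> ennreal"
  assumes [measurable]: "f \<in> borel_measurable borel"
  shows "(\<integral>\<^sup>+ x. f (x - c) \<partial>lborel) = (\<integral>\<^sup>+ x. f x \<partial>lborel)"
proof -
  have "(\<integral>\<^sup>+ x. f x \<partial>lborel) = (\<integral>\<^sup>+ x. f x \<partial>distr lborel borel ((+) (- c)))"
    by (simp add: lborel_distr_plus)
  also have "\<dots> = (\<integral>\<^sup>+ x. f (x - c) \<partial>lborel)"
    by (subst nn_integral_distr) auto
  finally show ?thesis by simp
qed

lemma lborel_integral_translate:
  fixes f :: "'a::euclidean_space \<Rightarrow> complex"
  assumes [measurable]: "f \<in> borel_measurable borel"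
  shows "(LINT x|lborel. f (x - c)) = (LINT x|lborel. f x)"
proof -
  have "(LINT x|lborel. f x) = (LINT x|distr lborel borel ((+) (- c)). f x)"
    by (simp add: lborel_distr_plus)
  also have "\<dots> = (LINT x|lborel. f (x - c))"
    by (subst integral_distr) auto
  finally show ?thesis by simp
qed

lemma measurable_cnj [measurable]: "cnj \<in> borel_measurable borel"
  by (intro borel_measurable_continuous_onI continuous_intros)

lemma measurable_cis [measurable]: "cis \<in> borel_measurable borel"
  unfolding cis_conv_exp by measurable

lemma stft_measurable [measurable]:
  fixes f \<gamma> :: "real^'n::finite \<Rightarrow> complex"
  assumes [measurable]: "f \<in> borel_measurable borel" "\<gamma> \<in> borel_measurable borel"
  shows "(\<lambda>(\<xi>, x). stft \<gamma> f x \<xi>) \<in> borel_measurable (lborel \<Otimes>\<^sub>M lborel)"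
    and "(\<lambda>x. stft \<gamma> f x \<xi>) \<in> borel_measurable borel"
  unfolding stft_def split_beta' by measurable

lemma stft_translate:
  fixes f \<gamma> :: "real^'n::finite \<Rightarrow> complex"
  assumes [measurable]: "f \<in> borel_measurable borel" "\<gamma> \<in> borel_measurable borel"
  shows "stft \<gamma> (\<lambda>t. f (t - c)) x \<xi> = cis (- (\<xi> \<bullet> c)) * stft \<gamma> f (x - c) \<xi>"
proof -
  have "stft \<gamma> (\<lambda>t. f (t - c)) x \<xi> =
     (LINT t|lborel. (\<lambda>s. cis (- (\<xi> \<bullet> c)) * (f s * cnj (cis (\<xi> \<bullet> s) * \<gamma> (s - (x - c))))) (t - c))"
    unfolding stft_def
    by (intro Bochner_Integration.integral_cong refl)
       (simp add: cis_cnj inner_diff_right cis_mult algebra_simps flip: cis_divide)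
  also have "\<dots> = (LINT s|lborel. cis (- (\<xi> \<bullet> c)) * (f s * cnj (cis (\<xi> \<bullet> s) * \<gamma> (s - (x - c)))))"
    by (rule lborel_integral_translate) measurable
  finally show ?thesis by (simp add: stft_def)
qed

text \<open>Translation costs a phase, which the modulus removes, and a shift in x, which the inner
  integral absorbs for each fixed frequency.\<close>

lemma mixed_stft_translate:
  fixes f \<gamma> :: "real^'n::finite \<Rightarrow> complex"
  assumes [measurable]: "f \<in> borel_measurable borel" "\<gamma> \<in> borel_measurable borel"
  shows "mixed p q (stft \<gamma> (\<lambda>t. f (t - c))) = mixed p q (stft \<gamma> f)"
proof -
  have "(\<integral>\<^sup>+ x. ennreal (norm (stft \<gamma> f (x - c) \<xi>) powr p) \<partial>lborel)
      = (\<integral>\<^sup>+ x. ennreal (norm (stft \<gamma> f x \<xi>) powr p) \<partial>lborel)" for \<xi>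
    by (rule nn_integral_lborel_translate) measurable
  then show ?thesis
    unfolding mixed_def by (simp add: stft_translate norm_mult)
qed

section \<open>Rudin--Shapiro polynomials\<close>

text \<open>The recursion sends a pair (P, Q) to (P + z^(2^j) Q, P - z^(2^j) Q). On the unit circle
  the monomial has modulus one, so by the parallelogram law the sum of the squares doubles. Since P
  occupies the degrees below 2^j, the two blocks of coefficients do not overlap and all moduli stay
  1.\<close>

lemma rudin_shapiro:
  "\<exists>a b :: nat \<Rightarrow> real. (\<forall>k. \<bar>a k\<bar> = 1) \<and> (\<forall>k. \<bar>b k\<bar> = 1) \<and>
     (\<forall>z::complex. norm z = 1 \<longrightarrow> (norm (\<Sum>k<2^j. of_real (a k) * z ^ k))\<^sup>2
        + (norm (\<Sum>k<2^j. of_real (b k) * z ^ k))\<^sup>2 = 2 * (2::real) ^ j)"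
proof (induction j)
  case 0
  show ?case by (intro exI[of _ "\<lambda>_. 1"]) auto
next
  case (Suc j)
  then obtain a b :: "nat \<Rightarrow> real" where ab: "\<And>k. \<bar>a k\<bar> = 1" "\<And>k. \<bar>b k\<bar> = 1"
    and id: "\<And>z::complex. norm z = 1 \<Longrightarrow> (norm (\<Sum>k<2^j. of_real (a k) * z ^ k))\<^sup>2
        + (norm (\<Sum>k<2^j. of_real (b k) * z ^ k))\<^sup>2 = 2 * (2::real) ^ j" by blast
  let ?c = "\<lambda>s k. if k < 2^j then a k else s * b (k - 2^j)"
  have split: "(\<Sum>k<2^Suc j. of_real (?c s k) * z ^ k) = (\<Sum>k<2^j. of_real (a k) * z ^ k)
       + of_real s * z ^ (2^j) * (\<Sum>k<2^j. of_real (b k) * z ^ k)" for s and z :: complex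
  proof -
    have "(\<Sum>k<m + n. g k) = (\<Sum>k<m. g k) + (\<Sum>k<n. g (m + k))" for m n and g :: "nat \<Rightarrow> complex"
      by (induction n) (auto simp: add.assoc)
    from this[of "\<lambda>k. of_real (?c s k) * z ^ k" "2^j" "2^j"]
    show ?thesis
      by (simp add: mult_2 power_add sum_distrib_left mult_ac)
  qed
  have par: "(norm (u + v))\<^sup>2 + (norm (u - v))\<^sup>2 = 2 * (norm u)\<^sup>2 + 2 * (norm v)\<^sup>2" for u v :: complex
    unfolding cmod_power2 by (simp add: power2_eq_square algebra_simps)
  show ?case
  proof (rule exI[of _ "?c 1"], rule exI[of _ "?c (-1)"], intro conjI allI impI)
    fix z :: complex assume z: "norm z = 1"
    show "(norm (\<Sum>k<2^Suc j. of_real (?c 1 k) * z ^ k))\<^sup>2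
        + (norm (\<Sum>k<2^Suc j. of_real (?c (-1) k) * z ^ k))\<^sup>2 = 2 * (2::real) ^ Suc j"
      unfolding split using par[of "\<Sum>k<2^j. of_real (a k) * z ^ k" "z ^ (2^j) * (\<Sum>k<2^j. of_real (b k) * z ^ k)"]
        id[OF z] z by (simp add: norm_mult norm_power)
  qed (use ab in \<open>auto simp: abs_mult\<close>)
qed

text \<open>Discarding the nonnegative square of the companion polynomial leaves the sup bound sqrt
  (2 N) with N = 2^j.\<close>

lemma rudin_shapiro_cis:
  obtains \<epsilon> :: "nat \<Rightarrow> real" where "\<And>k. \<bar>\<epsilon> k\<bar> = 1"
    "\<And>\<theta>. norm (\<Sum>k<2^j. of_real (\<epsilon> k) * cis (real k * \<theta>)) \<le> sqrt (2 * 2 ^ j)"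
proof -
  obtain a b :: "nat \<Rightarrow> real" where ab: "\<And>k. \<bar>a k\<bar> = 1"
    "\<And>z::complex. norm z = 1 \<Longrightarrow> (norm (\<Sum>k<2^j. of_real (a k) * z ^ k))\<^sup>2
        + (norm (\<Sum>k<2^j. of_real (b k) * z ^ k))\<^sup>2 = 2 * (2::real) ^ j"
    using rudin_shapiro[of j] by blast
  have "norm (\<Sum>k<2^j. of_real (a k) * cis (real k * \<theta>)) \<le> sqrt (2 * 2 ^ j)" for \<theta>
  proof (rule real_le_rsqrt)
    have "(norm (\<Sum>k<2^j. of_real (a k) * cis \<theta> ^ k))\<^sup>2 \<le> 2 * 2 ^ j"
      using ab(2)[OF norm_cis[of \<theta>]] zero_le_power2[of "norm (\<Sum>k<2^j. of_real (b k) * cis \<theta> ^ k)"]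
      by linarith
    then show "(norm (\<Sum>k<2^j. of_real (a k) * cis (real k * \<theta>)))\<^sup>2 \<le> 2 * 2 ^ j"
      by (simp only: Complex.DeMoivre)
  qed
  with ab(1) that show thesis by blast
qed

section \<open>Schwartz functions\<close>

abbreviation line :: "(real^'n::finite \<Rightarrow> complex) \<Rightarrow> 'n \<Rightarrow> real^'n \<Rightarrow> real \<Rightarrow> complex" where
  "line f i x \<equiv> (\<lambda>t. f (x + t *\<^sub>R axis i 1))"

lemma pderivs_append: "pderivs (is @ js) f = pderivs is (pderivs js f)"
  by (induction "is") auto

lemma schwartz_pderivs: "schwartz f \<Longrightarrow> schwartz (pderivs js f)"
  unfolding schwartz_def pderivs_append[symmetric] by blast

lemma schwartz_partial:
  fixes f :: "real^'n::finite \<Rightarrow> complex"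
  assumes "schwartz f"
  shows "(line f i x has_vector_derivative pderivs [i] f x) (at 0)"
proof -
  have "\<forall>i x. (line (pderivs [] f) i x) differentiable (at 0)"
    using assms unfolding schwartz_def by blast
  then show ?thesis
    by (simp add: vector_derivative_works)
qed

text \<open>\<open>schwartz\<close> speaks of derivatives at parameter 0 only. Moving the base point
  along the line gives the derivative at every parameter, as the mean value inequality
  requires.\<close>

lemma line_has_derivative:
  fixes f :: "real^'n::finite \<Rightarrow> complex"
  assumes "\<And>x. (line f i x has_vector_derivative f' x) (at 0)"
  shows "(line f i x has_vector_derivative f' (x + s *\<^sub>R axis i 1)) (at s within S)"
proof -
  have "(line f i (x + s *\<^sub>R axis i 1) has_vector_derivative f' (x + s *\<^sub>R axis i 1)) (at (s - s))"
    using assms by simp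
  then have "((\<lambda>t. line f i (x + s *\<^sub>R axis i 1) (t - s)) has_vector_derivative f' (x + s *\<^sub>R axis i 1)) (at s)"
    using vector_diff_chain_at[of "\<lambda>t. t - s" 1 s "line f i (x + s *\<^sub>R axis i 1)"]
      has_vector_derivative_diff_const[of "\<lambda>t. t" s 1 "at s"] has_vector_derivative_id[of "at s"]
    by (simp add: o_def)
  then have "(line f i x has_vector_derivative f' (x + s *\<^sub>R axis i 1)) (at s)"
    by (simp add: algebra_simps)
  then show ?thesis by (rule has_vector_derivative_at_within)
qed

text \<open>The iterated derivatives of f never leave a set that is closed under partial
  derivatives. Exhibiting such a set replaces explicit formulas for iterated derivatives of
  products.\<close>

lemma schwartz_coinduct:
  fixes f :: "real^'n::finite \<Rightarrow> complex"
  assumes "f \<in> S"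
    and deriv: "\<And>g i. g \<in> S \<Longrightarrow> \<exists>g'\<in>S. \<forall>x. (line g i x has_vector_derivative g' x) (at 0)"
    and bdd: "\<And>g k. g \<in> S \<Longrightarrow> bounded (range (\<lambda>x. norm x ^ k * norm (g x)))"
  shows "schwartz f"
proof -
  have in_S: "pderivs is f \<in> S" for "is"
  proof (induction "is")
    case Nil then show ?case using assms(1) by simp
  next
    case (Cons i "is")
    obtain g' where g': "g' \<in> S" "\<And>x. (line (pderivs is f) i x has_vector_derivative g' x) (at 0)"
      using deriv[OF Cons.IH] by blast
    then have "pderivs (i # is) f = g'"
      by (auto intro!: ext vector_derivative_at)
    then show ?case using g' by simp
  qed
  show ?thesis
    unfolding schwartz_def
  proof (intro conjI allI)
    show "line (pderivs is f) i x differentiable at 0" for "is" i x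
      using deriv[OF in_S[of "is"], of i]
      by (auto dest: differentiableI_vector)
  qed (rule bdd[OF in_S])
qed

text \<open>The weight 1 + \<open>norm x\<close> can be divided by even at the origin. It is
  controlled by the seminorms of orders 0 and k, and the factor 2^k comes from splitting at
  \<open>norm x = 1\<close>.\<close>

lemma schwartz_decay:
  fixes f :: "real^'n::finite \<Rightarrow> complex"
  assumes "schwartz f"
  obtains C where "0 \<le> C" "\<And>x. norm (f x) \<le> C / (1 + norm x) ^ k"
proof -
  have "bounded (range (\<lambda>x. norm x ^ k * norm (pderivs [] f x)))" for k
    using assms unfolding schwartz_def by blast
  then have "\<exists>B. \<forall>x. norm x ^ k * norm (f x) \<le> B" for k
    unfolding bounded_iff by (auto simp: abs_mult)
  then obtain B0 Bk where B: "\<And>x. norm (f x) \<le> B0" "\<And>x. norm x ^ k * norm (f x) \<le> Bk"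
    by (metis mult_1 power_0)
  have "norm (f x) \<le> (2 ^ k * (B0 + Bk)) / (1 + norm x) ^ k" for x
  proof -
    have "(1 + norm x) ^ k \<le> 2 ^ k * (1 + norm x ^ k)"
    proof (cases "norm x \<le> 1")
      case True
      then have "(1 + norm x) ^ k \<le> 2 ^ k" by (intro power_mono) auto
      also have "\<dots> \<le> 2 ^ k * (1 + norm x ^ k)" by simp
      finally show ?thesis .
    next
      case False
      then have "(1 + norm x) ^ k \<le> (2 * norm x) ^ k" by (intro power_mono) auto
      also have "\<dots> \<le> 2 ^ k * (1 + norm x ^ k)" by (simp add: power_mult_distrib)
      finally show ?thesis .
    qed
    then have "(1 + norm x) ^ k * norm (f x) \<le> 2 ^ k * (1 + norm x ^ k) * norm (f x)"
      by (intro mult_right_mono) auto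
    also have "\<dots> = 2 ^ k * (norm (f x) + norm x ^ k * norm (f x))" by (simp add: algebra_simps)
    also have "\<dots> \<le> 2 ^ k * (B0 + Bk)" using B by (intro mult_left_mono add_mono) auto
    finally show ?thesis
      by (subst pos_le_divide_eq) (auto simp: mult.commute add_pos_nonneg)
  qed
  moreover have "0 \<le> 2 ^ k * (B0 + Bk)"
    using order_trans[OF norm_ge_zero B(1)[of 0]] order_trans[OF mult_nonneg_nonneg B(2)[of 0]] by simp
  ultimately show thesis using that by blast
qed

text \<open>The derivative is bounded on the segment alone, so B may depend on x. This yields a
  decaying majorant for difference quotients.\<close>

lemma line_lipschitz:
  fixes f :: "real^'n::finite \<Rightarrow> complex"
  assumes "\<And>x. (line f i x has_vector_derivative f' x) (at 0)"
    and "\<And>r. r \<in> closed_segment 0 s \<Longrightarrow> norm (f' (x + r *\<^sub>R axis i 1)) \<le> B"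
  shows "norm (f (x + s *\<^sub>R axis i 1) - f x) \<le> B * \<bar>s\<bar>"
proof -
  have "norm (line f i x s - line f i x 0) \<le> B * norm (s - 0)"
  proof (rule differentiable_bound[of "closed_segment 0 s"])
    fix r assume r: "r \<in> closed_segment 0 s"
    show "(line f i x has_derivative (\<lambda>h. h *\<^sub>R f' (x + r *\<^sub>R axis i 1))) (at r within closed_segment 0 s)"
      using line_has_derivative[OF assms(1)] by (simp add: has_vector_derivative_def)
    show "onorm (\<lambda>h. h *\<^sub>R f' (x + r *\<^sub>R axis i 1)) \<le> B"
      using assms(2)[OF r] by (intro onorm_le) (simp add: mult.commute[of B] mult_left_mono)
  qed auto
  then show ?thesis by simp
qed

text \<open>Only partial derivatives are at hand, so the increment h is traversed one coordinate at
  a time. Each component is at most \<open>norm h\<close>, which produces the factor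
  \<open>CARD('n)\<close>.\<close>

lemma lipschitz_of_bounded_partials:
  fixes f :: "real^'n::finite \<Rightarrow> complex"
  assumes d: "\<And>i x. (line f i x has_vector_derivative f' i x) (at 0)"
    and B: "\<And>i x. norm (f' i x) \<le> B"
  shows "norm (f (x + h) - f x) \<le> B * real CARD('n) * norm h"
proof -
  have "norm (f (x + (\<Sum>i\<in>I. (h $ i) *\<^sub>R axis i 1)) - f x) \<le> B * (\<Sum>i\<in>I. \<bar>h $ i\<bar>)" if "finite I" for I
    using that
  proof (induction I)
    case (insert j I)
    let ?y = "x + (\<Sum>i\<in>I. (h $ i) *\<^sub>R axis i 1)"
    have "norm (f (?y + (h $ j) *\<^sub>R axis j 1) - f ?y) \<le> B * \<bar>h $ j\<bar>"
      by (rule line_lipschitz[OF d]) (rule B)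
    with insert have "norm (f (?y + (h $ j) *\<^sub>R axis j 1) - f x) \<le> B * \<bar>h $ j\<bar> + B * (\<Sum>i\<in>I. \<bar>h $ i\<bar>)"
      using norm_triangle_ineq[of "f (?y + (h $ j) *\<^sub>R axis j 1) - f ?y" "f ?y - f x"] by simp
    with insert show ?case by (simp add: algebra_simps)
  qed simp
  from this[of UNIV] have "norm (f (x + h) - f x) \<le> B * (\<Sum>i\<in>UNIV. \<bar>h $ i\<bar>)"
    using basis_expansion[of h] by (simp add: scalar_mult_eq_scaleR)
  also have "\<dots> \<le> B * (\<Sum>i\<in>(UNIV::'n set). norm h)"
    using B[of undefined 0] by (intro mult_left_mono sum_mono component_le_norm_cart) (simp_all add: order_trans[OF norm_ge_zero])
  finally show ?thesis by (simp add: mult.assoc)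
qed

lemma schwartz_lipschitz:
  fixes f :: "real^'n::finite \<Rightarrow> complex"
  assumes "schwartz f"
  obtains L where "0 \<le> L" "\<And>x h. norm (f (x + h) - f x) \<le> L * norm h"
proof -
  have "\<exists>B\<ge>0. \<forall>x. norm (pderivs [i] f x) \<le> B" for i
    using schwartz_decay[OF schwartz_pderivs[OF assms], of "[i]" 0] by auto
  then obtain B where B: "\<And>i. 0 \<le> B i" "\<And>i x. norm (pderivs [i] f x) \<le> B i" by metis
  have B': "norm (pderivs [i] f x) \<le> (\<Sum>i\<in>UNIV. B i)" for i x
    using B(2)[of i x] member_le_sum[of i UNIV B] B(1) by simp
  show thesis
    by (rule that[OF _ lipschitz_of_bounded_partials[OF schwartz_partial[OF assms] B']])
       (simp add: B sum_nonneg)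
qed

lemma schwartz_continuous:
  fixes f :: "real^'n::finite \<Rightarrow> complex"
  assumes "schwartz f" shows "continuous_on UNIV f"
proof -
  obtain L where L: "0 \<le> L" "\<And>x h. norm (f (x + h) - f x) \<le> L * norm h"
    using schwartz_lipschitz[OF assms] by blast
  have "L-lipschitz_on UNIV f"
    using L(1) L(2)[of y "x - y" for x y] by (intro lipschitz_onI) (auto simp: dist_norm)
  then show ?thesis by (rule lipschitz_on_continuous_on)
qed

lemma schwartz_measurable: "schwartz f \<Longrightarrow> f \<in> borel_measurable borel"
  by (intro borel_measurable_continuous_onI schwartz_continuous)

section \<open>Integrability from polynomial decay, and vanishing integrals of derivatives\<close>

lemma integrable_inverse_power_norm:
  "integrable lborel (\<lambda>x::real^'n::finite. 1 / (1 + norm x) ^ (CARD('n) + 2))"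
proof (rule integrableI_bounded)
  let ?n = "CARD('n)"
  let ?B = "unit_ball_vol (real ?n)"
  \<comment> \<open>The weight is compared with a series over the balls of radius 1 + k. The
    exponent n + 2 beats the volume growth (1 + k)^n by exactly two powers, which leaves the
    convergent sum of 1 / (1 + k)^2.\<close>
  have le: "ennreal (norm (1 / (1 + norm x) ^ (?n + 2)))
      \<le> (\<Sum>k. ennreal (1 / (1 + real k) ^ (?n + 2)) * indicator (cball 0 (1 + real k)) x)" for x :: "real^'n"
  proof -
    \<comment> \<open>The single term with k the integer part of \<open>norm x\<close> already
      dominates the weight at x.\<close>
    define k where "k = nat \<lfloor>norm x\<rfloor>"
    have k: "real k \<le> norm x" "norm x \<le> 1 + real k"
      unfolding k_def by (simp_all, linarith)
    define g where "g k = ennreal (1 / (1 + real k) ^ (?n + 2)) * indicator (cball 0 (1 + real k)) x" for k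
    have "1 / (1 + norm x) ^ (?n + 2) \<le> 1 / (1 + real k) ^ (?n + 2)"
      using k by (intro divide_left_mono power_mono mult_pos_pos zero_less_power) (auto intro: add_pos_nonneg)
    then have "ennreal (norm (1 / (1 + norm x) ^ (?n + 2))) \<le> sum g {k}"
      using k by (simp add: g_def ennreal_leI del: power_Suc add_2_eq_Suc add_2_eq_Suc')
    also have "\<dots> \<le> suminf g"
      by (rule sum_le_suminf) auto
    also have "suminf g = (\<Sum>k. ennreal (1 / (1 + real k) ^ (?n + 2)) * indicator (cball 0 (1 + real k)) x)"
      by (simp only: g_def[abs_def])
    finally show ?thesis .
  qed
  have "(\<integral>\<^sup>+ x. ennreal (norm (1 / (1 + norm (x::real^'n)) ^ (?n + 2))) \<partial>lborel)
     \<le> (\<integral>\<^sup>+ x. (\<Sum>k. ennreal (1 / (1 + real k) ^ (?n + 2)) * indicator (cball 0 (1 + real k)) (x::real^'n)) \<partial>lborel)"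
    by (intro nn_integral_mono le)
  also have "\<dots> = (\<Sum>k. \<integral>\<^sup>+ x. ennreal (1 / (1 + real k) ^ (?n + 2)) * indicator (cball 0 (1 + real k)) (x::real^'n) \<partial>lborel)"
    by (intro nn_integral_suminf borel_measurable_times_ennreal borel_measurable_const borel_measurable_indicator) simp
  also have "\<dots> = (\<Sum>k. ennreal (?B * (1 / (1 + real k) ^ 2)))"
  proof (rule suminf_cong)
    fix k
    have "(\<integral>\<^sup>+ x. ennreal (1 / (1 + real k) ^ (?n + 2)) * indicator (cball 0 (1 + real k)) (x::real^'n) \<partial>lborel)
       = ennreal (1 / (1 + real k) ^ (?n + 2)) * ennreal (?B * (1 + real k) ^ ?n)"
      using emeasure_cball[of "1 + real k" "0::real^'n"] by (subst nn_integral_cmult_indicator) simp_all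
    also have "\<dots> = ennreal (1 / (1 + real k) ^ (?n + 2) * (?B * (1 + real k) ^ ?n))"
      by (rule ennreal_mult[symmetric]) auto
    also have "1 / (1 + real k) ^ (?n + 2) * (?B * (1 + real k) ^ ?n) = ?B * (1 / (1 + real k) ^ 2)"
      by (simp add: power_add divide_simps power2_eq_square)
    finally show "(\<integral>\<^sup>+ x. ennreal (1 / (1 + real k) ^ (?n + 2)) * indicator (cball 0 (1 + real k)) (x::real^'n) \<partial>lborel) = ennreal (?B * (1 / (1 + real k) ^ 2))" .
  qed
  also have "\<dots> < \<infinity>"
  proof -
    have "summable (\<lambda>k. ?B * (1 / (1 + real k) ^ 2))"
      using summable_Suc_iff[THEN iffD2, OF inverse_power_summable[of 2, where 'a = real]]
      by (intro summable_mult) (simp add: inverse_eq_divide add.commute)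
    then show ?thesis
      by (subst suminf_ennreal2) auto
  qed
  finally show "(\<integral>\<^sup>+ x. ennreal (norm (1 / (1 + norm (x::real^'n)) ^ (?n + 2))) \<partial>lborel) < \<infinity>" .
  have "continuous_on UNIV (\<lambda>x::real^'n. 1 / (1 + norm x) ^ (?n + 2))"
    by (intro continuous_intros) (simp add: add_nonneg_eq_0_iff)
  then show "(\<lambda>x::real^'n. 1 / (1 + norm x) ^ (?n + 2)) \<in> borel_measurable lborel"
    using borel_measurable_continuous_onI by simp
qed

lemma integrable_of_decay:
  fixes f :: "real^'n::finite \<Rightarrow> 'b::{banach, second_countable_topology}"
  assumes "f \<in> borel_measurable borel" "\<And>x. norm (f x) \<le> C / (1 + norm x) ^ (CARD('n) + 2)"
  shows "integrable lborel f"
proof (rule Bochner_Integration.integrable_bound)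
  show "integrable lborel (\<lambda>x::real^'n. C * (1 / (1 + norm x) ^ (CARD('n) + 2)))"
    by (intro integrable_mult_right integrable_inverse_power_norm)
  show "AE x in lborel. norm (f x) \<le> norm (C * (1 / (1 + norm x) ^ (CARD('n) + 2)))"
    using order_trans[OF assms(2) abs_ge_self] by (intro AE_I2) (simp only: real_norm_def times_divide_eq_right mult_1_right)
qed (use assms(1) in simp)

lemma lborel_integrable_translate:
  fixes f :: "'a::euclidean_space \<Rightarrow> complex"
  assumes "integrable lborel f"
  shows "integrable lborel (\<lambda>x. f (x + c))"
proof -
  have "integrable (distr lborel borel ((+) c)) f"
    using assms by (simp add: lborel_distr_plus)
  then show ?thesis
    using assms by (subst (asm) integrable_distr_eq) (auto simp: add.commute)
qed

lemma inverse_le_divide_of_le_mult: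
  fixes a b K :: real
  assumes "0 < a" "0 < b" "b \<le> K * a" shows "1 / a \<le> K / b"
  using assms by (simp add: pos_divide_le_eq pos_le_divide_eq)

lemma norm_scaleR_inverse_le:
  fixes v :: "'a::real_normed_vector"
  assumes "0 < s" "norm v \<le> K * \<bar>s\<bar>" shows "norm (v /\<^sub>R s) \<le> K"
proof -
  have "norm v / s \<le> K" using assms by (simp add: pos_divide_le_eq)
  then show ?thesis using assms(1) by (simp add: divide_inverse mult.commute)
qed

lemma has_vector_derivative_quotient:
  fixes g :: "real \<Rightarrow> complex"
  assumes "(g has_vector_derivative D) (at 0)"
  shows "((\<lambda>t. (g t - g 0) /\<^sub>R t) \<longlongrightarrow> D) (at 0)"
proof -
  have lim: "((\<lambda>t. norm (g t - g 0 - t *\<^sub>R D) / \<bar>t\<bar>) \<longlongrightarrow> 0) (at 0)"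
    using assms by (simp add: has_vector_derivative_def has_derivative_at)
  have "norm (g t - g 0 - t *\<^sub>R D) / \<bar>t\<bar> = norm ((g t - g 0) /\<^sub>R t - D)" if "t \<noteq> 0" for t
  proof -
    have "(g t - g 0) /\<^sub>R t - D = (g t - g 0 - t *\<^sub>R D) /\<^sub>R t"
      using that by (simp add: scaleR_diff_right)
    then show ?thesis by (simp add: divide_inverse mult.commute)
  qed
  then have "\<forall>\<^sub>F t in at 0. norm (g t - g 0 - t *\<^sub>R D) / \<bar>t\<bar> = norm ((g t - g 0) /\<^sub>R t - D)"
    by (simp add: eventually_at_filter)
  with lim have "((\<lambda>t. norm ((g t - g 0) /\<^sub>R t - D)) \<longlongrightarrow> 0) (at 0)"
    by (rule Lim_transform_eventually)
  then show ?thesis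
    by (rule LIM_zero_cancel[OF tendsto_norm_zero_cancel])
qed

text \<open>Difference quotients integrate to zero by translation invariance; pass to the limit.\<close>
lemma integral_partial_eq_0:
  fixes h :: "real^'n::finite \<Rightarrow> complex"
  assumes d: "\<And>x. (line h i x has_vector_derivative h' x) (at 0)"
    and [measurable]: "h \<in> borel_measurable borel" "h' \<in> borel_measurable borel"
    and int: "integrable lborel h"
    and bd: "\<And>x. norm (h' x) \<le> C / (1 + norm x) ^ (CARD('n) + 2)"
  shows "(LINT x|lborel. h' x) = 0"
proof -
  let ?M = "CARD('n) + 2"
  define s where "s j = 1 / (1 + real j)" for j
  define Q where "Q j x = (h (x + s j *\<^sub>R axis i 1) - h x) /\<^sub>R s j" for j x
  have s: "0 < s j" "s j \<le> 1" for j by (auto simp: s_def)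
  have C: "0 \<le> C" using order_trans[OF norm_ge_zero bd[of 0]] by simp
  have "(\<lambda>j. LINT x|lborel. Q j x) \<longlonglongrightarrow> (LINT x|lborel. h' x)"
  proof (rule integral_dominated_convergence)
    show "integrable lborel (\<lambda>x::real^'n. C * 2 ^ ?M * (1 / (1 + norm x) ^ ?M))"
      by (intro integrable_mult_right integrable_inverse_power_norm)
    show "AE x in lborel. (\<lambda>j. Q j x) \<longlonglongrightarrow> h' x"
    proof (rule AE_I2)
      fix x
      have "filterlim s (at 0) sequentially"
        using LIMSEQ_inverse_real_of_nat unfolding filterlim_at s_def
        by (auto simp: inverse_eq_divide)
      moreover have "((\<lambda>t. (line h i x t - line h i x 0) /\<^sub>R t) \<longlongrightarrow> h' x) (at 0)"
        by (rule has_vector_derivative_quotient[OF d])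
      ultimately show "(\<lambda>j. Q j x) \<longlonglongrightarrow> h' x"
        unfolding Q_def by (auto dest: filterlim_compose)
    qed
    show "AE x in lborel. norm (Q j x) \<le> C * 2 ^ ?M * (1 / (1 + norm x) ^ ?M)" for j
    proof (rule AE_I2)
      fix x :: "real^'n"
      have "norm (h (x + s j *\<^sub>R axis i 1) - h x) \<le> (C * 2 ^ ?M * (1 / (1 + norm x) ^ ?M)) * \<bar>s j\<bar>"
      proof (rule line_lipschitz[OF d])
        fix r assume "r \<in> closed_segment 0 (s j)"
        then have r: "0 \<le> r" "r \<le> 1"
          using s[of j] by (auto simp: closed_segment_eq_real_ivl)
        \<comment> \<open>Moving by at most one unit changes 1 + \<open>norm x\<close> by at most a
          factor 2. Hence the factor 2^(n + 2) in the majorant, which is uniform in the step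
          size.\<close>
        define y where "y = x + r *\<^sub>R axis i 1"
        have "norm x \<le> norm y + norm (r *\<^sub>R (axis i 1 :: real^'n))"
          unfolding y_def by (metis add_diff_cancel norm_triangle_ineq4)
        then have "norm x \<le> norm y + 1"
          using r by (simp add: norm_axis_1)
        then have "1 + norm x \<le> 2 * (1 + norm y)"
          using norm_ge_zero[of y] by argo
        then have "(1 + norm x) ^ ?M \<le> 2 ^ ?M * (1 + norm y) ^ ?M"
          unfolding power_mult_distrib[symmetric] by (intro power_mono) auto
        then have "1 / (1 + norm y) ^ ?M \<le> 2 ^ ?M / (1 + norm x) ^ ?M"
          by (intro inverse_le_divide_of_le_mult zero_less_power) (auto intro: add_pos_nonneg)
        then have "C * (1 / (1 + norm y) ^ ?M) \<le> C * (2 ^ ?M / (1 + norm x) ^ ?M)"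
          using C by (intro mult_left_mono)
        then show "norm (h' (x + r *\<^sub>R axis i 1)) \<le> C * 2 ^ ?M * (1 / (1 + norm x) ^ ?M)"
          using bd[of y] unfolding y_def by simp
      qed
      then show "norm (Q j x) \<le> C * 2 ^ ?M * (1 / (1 + norm x) ^ ?M)"
        unfolding Q_def by (intro norm_scaleR_inverse_le s)
    qed
  qed (auto simp: Q_def)
  moreover have "(LINT x|lborel. Q j x) = 0" for j
  proof -
    have "(LINT x|lborel. h (x + s j *\<^sub>R axis i 1)) = (LINT x|lborel. h x)"
      using lborel_integral_translate[of h "- (s j *\<^sub>R axis i 1)"] by simp
    then show ?thesis
      unfolding Q_def using int lborel_integrable_translate[OF int]
      by (simp add: Bochner_Integration.integral_diff)
  qed
  ultimately show ?thesis
    by (simp add: LIMSEQ_const_iff)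
qed

section \<open>Decay of the short-time Fourier transform\<close>

text \<open>Since 1 + |x| is at most (1 + |t|) (1 + |t - x|), M powers of decay of u in t and M
  powers of decay of v in t - x can be exchanged for M powers of decay in x. The remaining n + 2
  powers of u keep the product integrable in t.\<close>

lemma stft_bound:
  fixes u v :: "real^'n::finite \<Rightarrow> complex"
  assumes u: "schwartz u" and v: "schwartz v"
  obtains C where "0 \<le> C"
    "\<And>x t. norm (u t * cnj (v (t - x))) \<le> C / ((1 + norm t) ^ (CARD('n) + 2) * (1 + norm x) ^ M)"
proof -
  let ?M = "CARD('n) + 2"
  obtain A where A: "0 \<le> A" "\<And>t. norm (u t) \<le> A / (1 + norm t) ^ (?M + M)"
    using schwartz_decay[OF u] by blast
  obtain B where B: "0 \<le> B" "\<And>t. norm (v t) \<le> B / (1 + norm t) ^ M"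
    using schwartz_decay[OF v] by blast
  show thesis
  proof (rule that[of "A * B"])
    fix x t :: "real^'n"
    have "norm x \<le> norm t + norm (t - x)" by (metis norm_triangle_sub norm_minus_commute add.commute)
    then have "1 + norm x \<le> (1 + norm t) * (1 + norm (t - x))"
      using mult_nonneg_nonneg[OF norm_ge_zero[of t] norm_ge_zero[of "t - x"]]
      unfolding distrib_left distrib_right by linarith
    then have "(1 + norm x) ^ M \<le> ((1 + norm t) * (1 + norm (t - x))) ^ M"
      by (intro power_mono) auto
    then have *: "(1 + norm t) ^ ?M * (1 + norm x) ^ M \<le> (1 + norm t) ^ (?M + M) * (1 + norm (t - x)) ^ M"
      unfolding power_mult_distrib power_add[of _ ?M M] mult.assoc by (intro mult_left_mono) auto
    have "norm (u t * cnj (v (t - x))) \<le> (A / (1 + norm t) ^ (?M + M)) * (B / (1 + norm (t - x)) ^ M)"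
      unfolding norm_mult complex_mod_cnj using A B by (intro mult_mono) (auto intro!: divide_nonneg_nonneg)
    also have "\<dots> = A * B / ((1 + norm t) ^ (?M + M) * (1 + norm (t - x)) ^ M)" by simp
    also have "\<dots> \<le> A * B / ((1 + norm t) ^ ?M * (1 + norm x) ^ M)"
      using A B * by (intro divide_left_mono mult_pos_pos zero_less_power mult_nonneg_nonneg)
        (auto intro: add_pos_nonneg)
    finally show "norm (u t * cnj (v (t - x))) \<le> A * B / ((1 + norm t) ^ ?M * (1 + norm x) ^ M)" .
  qed (use A B in simp)
qed

lemma stft_integrable:
  fixes u v :: "real^'n::finite \<Rightarrow> complex"
  assumes u: "schwartz u" and v: "schwartz v"
  shows "integrable lborel (\<lambda>t. u t * cnj (cis (\<xi> \<bullet> t) * v (t - x)))"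
proof -
  note [measurable] = schwartz_measurable[OF u] schwartz_measurable[OF v]
  obtain C where "\<And>x t. norm (u t * cnj (v (t - x))) \<le> C / ((1 + norm t) ^ (CARD('n) + 2) * (1 + norm x) ^ 0)"
    using stft_bound[OF u v] by metis
  then have "\<And>t. norm (u t * cnj (cis (\<xi> \<bullet> t) * v (t - x))) \<le> C / (1 + norm t) ^ (CARD('n) + 2)"
    unfolding norm_mult complex_mod_cnj norm_cis power_0 mult_1 mult_1_right .
  then show ?thesis
    by (intro integrable_of_decay) measurable
qed

lemma stft_decay_x:
  fixes u v :: "real^'n::finite \<Rightarrow> complex"
  assumes u: "schwartz u" and v: "schwartz v"
  obtains C where "0 \<le> C" "\<And>x \<xi>. norm (stft v u x \<xi>) \<le> C / (1 + norm x) ^ M"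
proof -
  let ?M = "CARD('n) + 2"
  let ?I = "LINT t|lborel. 1 / (1 + norm (t::real^'n)) ^ ?M"
  obtain C where C: "0 \<le> C" "\<And>x t. norm (u t * cnj (v (t - x))) \<le> C / ((1 + norm t) ^ ?M * (1 + norm x) ^ M)"
    using stft_bound[OF u v] by metis
  show thesis
  proof (rule that[of "C * ?I"])
    fix x \<xi> :: "real^'n"
    have "norm (stft v u x \<xi>) \<le> (LINT t|lborel. (C / (1 + norm x) ^ M) * (1 / (1 + norm (t::real^'n)) ^ ?M))"
      unfolding stft_def
    proof (rule Bochner_Integration.integral_norm_bound_integral[OF stft_integrable[OF u v]])
      show "integrable lborel (\<lambda>t::real^'n. (C / (1 + norm x) ^ M) * (1 / (1 + norm t) ^ ?M))"
        by (intro integrable_mult_right integrable_inverse_power_norm)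
      show "norm (u t * cnj (cis (\<xi> \<bullet> t) * v (t - x))) \<le> (C / (1 + norm x) ^ M) * (1 / (1 + norm t) ^ ?M)" for t
        using C(2)[of t x] unfolding norm_mult complex_mod_cnj norm_cis by (simp add: mult.commute)
    qed
    also have "\<dots> = C / (1 + norm x) ^ M * ?I"
      by (rule integral_mult_right_zero)
    finally show "norm (stft v u x \<xi>) \<le> C * ?I / (1 + norm x) ^ M" by simp
  qed (use C in \<open>auto intro!: mult_nonneg_nonneg integral_nonneg_AE AE_I2 divide_nonneg_nonneg\<close>)
qed

lemma cis_line_has_vector_derivative:
  fixes \<xi> t :: "real^'n::finite"
  shows "((\<lambda>s. cis (\<xi> \<bullet> (t + s *\<^sub>R axis i 1))) has_vector_derivative (\<xi> $ i) *\<^sub>R (\<i> * cis (\<xi> \<bullet> t))) (at 0)"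
proof -
  have "((\<lambda>z. exp (\<i> * (of_real (\<xi> \<bullet> t) + z * of_real (\<xi> $ i)))) has_field_derivative
      (\<xi> $ i) *\<^sub>R (\<i> * cis (\<xi> \<bullet> t))) (at (of_real 0))"
    unfolding cis_conv_exp by (auto intro!: derivative_eq_intros simp: scaleR_conv_of_real)
  from has_vector_derivative_real_field[OF this] show ?thesis
    by (simp add: cis_conv_exp inner_add_right inner_axis)
qed

text \<open>Integration by parts: the derivative of the whole integrand has integral zero, and the
  part of it that falls on the conjugated exponential produces the factor \<xi>_i.\<close>

lemma stft_partial:
  fixes u v :: "real^'n::finite \<Rightarrow> complex"
  assumes u: "schwartz u" and v: "schwartz v"
  shows "\<i> * of_real (\<xi> $ i) * stft v u x \<xi> = stft v (pderivs [i] u) x \<xi> + stft (pderivs [i] v) u x \<xi>"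
proof -
  let ?M = "CARD('n) + 2"
  let ?h = "\<lambda>v u t. u t * cnj (cis (\<xi> \<bullet> t) * v (t - x))"
  let ?u = "pderivs [i] u" and ?v = "pderivs [i] v"
  note u' = schwartz_pderivs[OF u, of "[i]"] and v' = schwartz_pderivs[OF v, of "[i]"]
  note [measurable] = schwartz_measurable[OF u] schwartz_measurable[OF v]
    schwartz_measurable[OF u'] schwartz_measurable[OF v']
  let ?h' = "\<lambda>t. ?h v ?u t + ?h ?v u t - \<i> * of_real (\<xi> $ i) * ?h v u t"
  have "(LINT t|lborel. ?h' t) = 0"
  proof -
    have d: "(line (?h v u) i t has_vector_derivative ?h' t) (at 0)" for t
    proof -
      have 1: "(line u i t has_vector_derivative ?u t) (at 0)"
        by (rule schwartz_partial[OF u])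
      have 2: "((\<lambda>s. v (t + s *\<^sub>R axis i 1 - x)) has_vector_derivative ?v (t - x)) (at 0)"
        using schwartz_partial[OF v, where i = i and x = "t - x"] by (simp add: algebra_simps)
      have 3: "((\<lambda>s. cis (\<xi> \<bullet> (t + s *\<^sub>R axis i 1))) has_vector_derivative (\<xi> $ i) *\<^sub>R (\<i> * cis (\<xi> \<bullet> t))) (at 0)"
        by (rule cis_line_has_vector_derivative)
      have 4: "((\<lambda>s. u (t + s *\<^sub>R axis i 1) * cnj (cis (\<xi> \<bullet> (t + s *\<^sub>R axis i 1)) * v (t + s *\<^sub>R axis i 1 - x)))
          has_vector_derivative (u t * cnj (cis (\<xi> \<bullet> t) * ?v (t - x) + (\<xi> $ i) *\<^sub>R (\<i> * cis (\<xi> \<bullet> t)) * v (t - x))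
             + ?u t * cnj (cis (\<xi> \<bullet> t) * v (t - x)))) (at 0)"
        using has_vector_derivative_mult[OF 1 has_vector_derivative_cnj[OF has_vector_derivative_mult[OF 3 2]]] by simp
      show ?thesis
        using 4 by (rule has_vector_derivative_eq_rhs) (simp add: algebra_simps scaleR_conv_of_real)
    qed
    obtain C1 where C1: "0 \<le> C1" "\<And>x t. norm (u t * cnj (v (t - x))) \<le> C1 / ((1 + norm t) ^ ?M * (1 + norm x) ^ 0)"
      using stft_bound[OF u v] by metis
    obtain C2 where C2: "0 \<le> C2" "\<And>x t. norm (?u t * cnj (v (t - x))) \<le> C2 / ((1 + norm t) ^ ?M * (1 + norm x) ^ 0)"
      using stft_bound[OF u' v] by metis
    obtain C3 where C3: "0 \<le> C3" "\<And>x t. norm (u t * cnj (?v (t - x))) \<le> C3 / ((1 + norm t) ^ ?M * (1 + norm x) ^ 0)"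
      using stft_bound[OF u v'] by metis
    have "norm (?h' t) \<le> (C2 + C3 + \<bar>\<xi> $ i\<bar> * C1) / (1 + norm t) ^ ?M" for t
    proof -
      have "norm (?h v u t) \<le> C1 / (1 + norm t) ^ ?M" "norm (?h v ?u t) \<le> C2 / (1 + norm t) ^ ?M"
        "norm (?h ?v u t) \<le> C3 / (1 + norm t) ^ ?M"
        using C1(2)[of t x] C2(2)[of t x] C3(2)[of t x]
        unfolding norm_mult complex_mod_cnj norm_cis power_0 mult_1 mult_1_right by blast+
      moreover have "norm (?h' t) \<le> norm (?h v ?u t) + norm (?h ?v u t) + \<bar>\<xi> $ i\<bar> * norm (?h v u t)"
        by (rule order_trans[OF norm_triangle_ineq4 add_mono[OF norm_triangle_ineq]])
           (simp add: norm_mult)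
      moreover have "\<bar>\<xi> $ i\<bar> * norm (?h v u t) \<le> \<bar>\<xi> $ i\<bar> * (C1 / (1 + norm t) ^ ?M)"
        using calculation(1) by (intro mult_left_mono) auto
      ultimately show ?thesis
        unfolding add_divide_distrib by (simp only: times_divide_eq_right)
    qed
    from integral_partial_eq_0[OF d _ _ stft_integrable[OF u v] this] show ?thesis
      by measurable
  qed
  moreover have "(LINT t|lborel. ?h' t) = stft v ?u x \<xi> + stft ?v u x \<xi> - \<i> * of_real (\<xi> $ i) * stft v u x \<xi>"
  proof -
    note i = stft_integrable[OF u' v, of \<xi> x] stft_integrable[OF u v', of \<xi> x] stft_integrable[OF u v, of \<xi> x]
    have "(LINT t|lborel. ?h' t) = (LINT t|lborel. ?h v ?u t + ?h ?v u t) - (LINT t|lborel. \<i> * of_real (\<xi> $ i) * ?h v u t)"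
      by (intro Bochner_Integration.integral_diff Bochner_Integration.integrable_add integrable_mult_right i)
    also have "(LINT t|lborel. ?h v ?u t + ?h ?v u t) = (LINT t|lborel. ?h v ?u t) + (LINT t|lborel. ?h ?v u t)"
      by (intro Bochner_Integration.integral_add i)
    also have "(LINT t|lborel. \<i> * of_real (\<xi> $ i) * ?h v u t) = \<i> * of_real (\<xi> $ i) * (LINT t|lborel. ?h v u t)"
      by (rule integral_mult_right_zero)
    finally show ?thesis unfolding stft_def .
  qed
  ultimately show ?thesis by simp
qed

text \<open>Each power of \<xi>_i is paid for by one derivative on u or on v. Both stay Schwartz but
  change from step to step, so the induction runs over arbitrary u and v.\<close>

lemma stft_decay_component:
  fixes u v :: "real^'n::finite \<Rightarrow> complex"
  assumes "schwartz u" "schwartz v"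
  shows "\<exists>C\<ge>0. \<forall>x \<xi>. \<bar>\<xi> $ i\<bar> ^ k * norm (stft v u x \<xi>) \<le> C / (1 + norm x) ^ M"
  using assms
proof (induction k arbitrary: u v)
  case 0
  then show ?case using stft_decay_x[of u v M] by (metis mult_1 power_0)
next
  case (Suc k)
  let ?u = "pderivs [i] u" and ?v = "pderivs [i] v"
  obtain C1 where C1: "0 \<le> C1" "\<And>x \<xi>. \<bar>\<xi> $ i\<bar> ^ k * norm (stft v ?u x \<xi>) \<le> C1 / (1 + norm x) ^ M"
    using Suc.IH[OF schwartz_pderivs[OF Suc.prems(1)] Suc.prems(2)] by blast
  obtain C2 where C2: "0 \<le> C2" "\<And>x \<xi>. \<bar>\<xi> $ i\<bar> ^ k * norm (stft ?v u x \<xi>) \<le> C2 / (1 + norm x) ^ M"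
    using Suc.IH[OF Suc.prems(1) schwartz_pderivs[OF Suc.prems(2)]] by blast
  have "\<bar>\<xi> $ i\<bar> ^ Suc k * norm (stft v u x \<xi>) \<le> (C1 + C2) / (1 + norm x) ^ M" for x \<xi>
  proof -
    have "\<bar>\<xi> $ i\<bar> ^ Suc k * norm (stft v u x \<xi>) = \<bar>\<xi> $ i\<bar> ^ k * norm (\<i> * of_real (\<xi> $ i) * stft v u x \<xi>)"
      by (simp add: norm_mult mult_ac)
    also have "\<dots> \<le> \<bar>\<xi> $ i\<bar> ^ k * (norm (stft v ?u x \<xi>) + norm (stft ?v u x \<xi>))"
      unfolding stft_partial[OF Suc.prems] by (intro mult_left_mono norm_triangle_ineq) auto
    also have "\<dots> \<le> (C1 + C2) / (1 + norm x) ^ M"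
      unfolding distrib_left add_divide_distrib by (intro add_mono C1 C2)
    finally show ?thesis .
  qed
  with C1(1) C2(1) show ?case by (intro exI[of _ "C1 + C2"]) simp
qed

lemma stft_decay:
  fixes u v :: "real^'n::finite \<Rightarrow> complex"
  assumes uv: "schwartz u" "schwartz v"
  obtains C where "0 < C" "\<And>x \<xi>. norm (stft v u x \<xi>) \<le> C / ((1 + norm x) ^ M * (1 + norm \<xi>) ^ k)"
proof -
  let ?n = "real CARD('n)"
  obtain C0 where C0: "0 \<le> C0" "\<And>x \<xi>. norm (stft v u x \<xi>) \<le> C0 / (1 + norm x) ^ M"
    using stft_decay_x[OF uv] by metis
  obtain B where B: "\<And>i. 0 \<le> B i" "\<And>i x \<xi>. \<bar>\<xi> $ i\<bar> ^ k * norm (stft v u x \<xi>) \<le> B i / (1 + norm x) ^ M"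
    using stft_decay_component[OF uv, of _ k M] by metis
  define S where "S = (\<Sum>i\<in>UNIV. B i)"
  have S: "0 \<le> S" "B i \<le> S" for i
    unfolding S_def using B(1) member_le_sum[of i UNIV B] by (auto intro: sum_nonneg)
  define C where "C = (1 + ?n) ^ k * (C0 + S)"
  have bound: "norm (stft v u x \<xi>) \<le> C / ((1 + norm x) ^ M * (1 + norm \<xi>) ^ k)" for x \<xi>
  proof -
    \<comment> \<open>The largest component controls \<open>norm \<xi>\<close> up to the dimension.
      Its index varies with \<xi>, which is why the constants of all components were summed in
      S.\<close>
    obtain i where i: "\<And>j. \<bar>\<xi> $ j\<bar> \<le> \<bar>\<xi> $ i\<bar>"
    proof -
      have "Max (range (\<lambda>j. \<bar>\<xi> $ j\<bar>)) \<in> range (\<lambda>j. \<bar>\<xi> $ j\<bar>)" by (rule Max_in) auto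
      then obtain i where "Max (range (\<lambda>j. \<bar>\<xi> $ j\<bar>)) = \<bar>\<xi> $ i\<bar>" by (rule rangeE)
      then show thesis using that[of i] by (metis Max_ge finite finite_imageI rangeI)
    qed
    let ?a = "\<bar>\<xi> $ i\<bar>" and ?V = "norm (stft v u x \<xi>)"
    have "norm \<xi> \<le> (\<Sum>j\<in>UNIV. \<bar>\<xi> $ j\<bar>)" by (rule norm_le_l1_cart)
    also have "\<dots> \<le> ?n * ?a" using sum_bounded_above[of UNIV "\<lambda>j. \<bar>\<xi> $ j\<bar>" ?a] i by simp
    also have "\<dots> \<le> ?n * max 1 ?a" by (intro mult_left_mono) auto
    finally have "1 + norm \<xi> \<le> (1 + ?n) * max 1 ?a" by (simp add: distrib_right)
    then have "(1 + norm \<xi>) ^ k \<le> ((1 + ?n) * max 1 ?a) ^ k" by (intro power_mono) auto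
    also have "\<dots> = (1 + ?n) ^ k * max 1 ?a ^ k" by (rule power_mult_distrib)
    also have "max 1 ?a ^ k \<le> 1 + ?a ^ k" by (simp add: max_def)
    finally have "(1 + norm \<xi>) ^ k \<le> (1 + ?n) ^ k * (1 + ?a ^ k)" by (simp add: mult_left_mono)
    then have "(1 + norm \<xi>) ^ k * ?V \<le> (1 + ?n) ^ k * (1 + ?a ^ k) * ?V"
      by (intro mult_right_mono) auto
    also have "\<dots> = (1 + ?n) ^ k * (?V + ?a ^ k * ?V)" by (simp add: algebra_simps)
    also have "\<dots> \<le> (1 + ?n) ^ k * (C0 / (1 + norm x) ^ M + B i / (1 + norm x) ^ M)"
      by (intro mult_left_mono add_mono C0 B) auto
    also have "\<dots> = (1 + ?n) ^ k * (C0 + B i) / (1 + norm x) ^ M"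
      by (simp only: add_divide_distrib times_divide_eq_right distrib_left)
    also have "\<dots> \<le> C / (1 + norm x) ^ M"
      unfolding C_def using S(2)[of i] by (intro divide_right_mono mult_left_mono) auto
    finally have "?V * (1 + norm \<xi>) ^ k \<le> C / (1 + norm x) ^ M" by (simp only: mult.commute)
    then have "?V \<le> C / (1 + norm x) ^ M / (1 + norm \<xi>) ^ k"
      by (subst pos_le_divide_eq) (auto intro!: zero_less_power add_pos_nonneg)
    then show ?thesis by (simp only: divide_divide_eq_left)
  qed
  show thesis
  \<comment> \<open>Adding 1 makes the constant strictly positive.\<close>
  proof (rule that[of "C + 1"])
    have "0 \<le> C" unfolding C_def using C0(1) S(1) by simp
    then show "0 < C + 1" by simp
    show "norm (stft v u x \<xi>) \<le> (C + 1) / ((1 + norm x) ^ M * (1 + norm \<xi>) ^ k)" for x \<xi>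
      by (rule order_trans[OF bound]) (intro divide_right_mono mult_nonneg_nonneg; simp)
  qed
qed

section \<open>Schwartz functions under modulation and translation\<close>

inductive_set modulation_span :: "(real^'n::finite \<Rightarrow> complex) \<Rightarrow> (real^'n \<Rightarrow> complex) set"
  for \<gamma> :: "real^'n::finite \<Rightarrow> complex" where
  base: "(\<lambda>t. c * cis (a \<bullet> t) * pderivs is \<gamma> t) \<in> modulation_span \<gamma>"
| add: "f \<in> modulation_span \<gamma> \<Longrightarrow> g \<in> modulation_span \<gamma> \<Longrightarrow> (\<lambda>t. f t + g t) \<in> modulation_span \<gamma>"

text \<open>The span is the invariant set for \<open>schwartz_coinduct\<close>. A partial derivative
  of a modulated derivative of \<gamma> is a sum of two such terms, one with a further derivative
  and one with the factor \<open>\<i> * a $ i\<close>.\<close>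

lemma schwartz_modulation_span:
  assumes \<gamma>: "schwartz \<gamma>" and "f \<in> modulation_span \<gamma>"
  shows "schwartz f"
proof (rule schwartz_coinduct[OF assms(2)])
  fix g i assume "g \<in> modulation_span \<gamma>"
  then show "\<exists>g'\<in>modulation_span \<gamma>. \<forall>x. (line g i x has_vector_derivative g' x) (at 0)"
  proof induction
    case (base c a "is")
    let ?g' = "\<lambda>t. c * cis (a \<bullet> t) * pderivs (i # is) \<gamma> t + (c * (of_real (a $ i) * \<i>)) * cis (a \<bullet> t) * pderivs is \<gamma> t"
    have "(line (\<lambda>t. c * cis (a \<bullet> t) * pderivs is \<gamma> t) i x has_vector_derivative ?g' x) (at 0)" for x
    proof -
      have "(line (pderivs is \<gamma>) i x has_vector_derivative pderivs (i # is) \<gamma> x) (at 0)"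
        using schwartz_partial[OF schwartz_pderivs[OF \<gamma>, of "is"]] by simp
      from has_vector_derivative_mult[OF has_vector_derivative_mult[OF has_vector_derivative_const[of c] cis_line_has_vector_derivative] this]
      show ?thesis
        by (rule has_vector_derivative_eq_rhs) (simp add: scaleR_conv_of_real mult_ac)
    qed
    moreover have "?g' \<in> modulation_span \<gamma>"
      by (intro modulation_span.intros)
    ultimately show ?case by (intro bexI[of _ ?g'] allI)
  next
    case (add f g)
    then obtain f' g' where "f' \<in> modulation_span \<gamma>" "g' \<in> modulation_span \<gamma>"
      "\<forall>x. (line f i x has_vector_derivative f' x) (at 0)" "\<forall>x. (line g i x has_vector_derivative g' x) (at 0)"
      by blast
    then show ?case
      by (intro bexI[of _ "\<lambda>t. f' t + g' t"] allI has_vector_derivative_add modulation_span.add) auto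
  qed
next
  fix g and k :: nat assume "g \<in> modulation_span \<gamma>"
  then have "\<exists>B. \<forall>x. norm x ^ k * norm (g x) \<le> B"
  proof induction
    case (base c a "is")
    have "bounded (range (\<lambda>x. norm x ^ k * norm (pderivs is \<gamma> x)))"
      using \<gamma> unfolding schwartz_def by blast
    then obtain B where "\<And>x. norm x ^ k * norm (pderivs is \<gamma> x) \<le> B"
      unfolding bounded_iff by (auto simp: abs_mult)
    then have "norm c * (norm x ^ k * norm (pderivs is \<gamma> x)) \<le> norm c * B" for x
      by (intro mult_left_mono) auto
    then show ?case by (auto simp: norm_mult mult_ac)
  next
    case (add f g)
    then obtain A B where "\<And>x. norm x ^ k * norm (f x) \<le> A" "\<And>x. norm x ^ k * norm (g x) \<le> B" by blast
    then have "norm x ^ k * norm (f x + g x) \<le> A + B" for x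
      by (intro order_trans[OF mult_left_mono[OF norm_triangle_ineq]]) (auto simp: distrib_left intro: add_mono)
    then show ?case by blast
  qed
  then show "bounded (range (\<lambda>x. norm x ^ k * norm (g x)))"
    unfolding bounded_iff by (auto simp: abs_mult)
qed

lemma schwartz_modulations:
  assumes "schwartz \<gamma>" and "finite J"
  shows "schwartz (\<lambda>t. (\<Sum>j\<in>J. c j * cis (a j \<bullet> t)) * \<gamma> t)"
proof -
  have "(\<lambda>t. (\<Sum>j\<in>J. c j * cis (a j \<bullet> t)) * \<gamma> t) \<in> modulation_span \<gamma>"
    using assms(2)
  proof induction
    case empty
    show ?case using modulation_span.base[of 0 _ "[]" \<gamma>] by simp
  next
    case (insert j J)
    with modulation_span.add[OF modulation_span.base[of "c j" "a j" "[]" \<gamma>] insert.IH]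
    show ?case by (simp add: distrib_right)
  qed
  then show ?thesis using assms(1) schwartz_modulation_span by blast
qed

text \<open>The invariant set consists of the translates of all iterated derivatives of f. Moving
  the weight from x to x - c costs the factor (1 + |c|)^k.\<close>

lemma schwartz_translate:
  fixes f :: "real^'n::finite \<Rightarrow> complex"
  assumes f: "schwartz f" shows "schwartz (\<lambda>t. f (t - c))"
proof (rule schwartz_coinduct)
  let ?S = "range (\<lambda>is t. pderivs is f (t - c))"
  show "(\<lambda>t. f (t - c)) \<in> ?S" by (rule range_eqI[of _ _ "[]"]) simp
  show "\<exists>g'\<in>?S. \<forall>x. (line g i x has_vector_derivative g' x) (at 0)" if g: "g \<in> ?S" for g i
  proof -
    obtain "is" where g: "g = (\<lambda>t. pderivs is f (t - c))" using g by blast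
    have "(line g i x has_vector_derivative pderivs (i # is) f (x - c)) (at 0)" for x
      using schwartz_partial[OF schwartz_pderivs[OF f, of "is"], where x = "x - c" and i = i]
      by (simp add: g algebra_simps)
    then show ?thesis
      by (intro bexI[of _ "\<lambda>t. pderivs (i # is) f (t - c)"] allI rangeI)
  qed
  show "bounded (range (\<lambda>x. norm x ^ k * norm (g x)))" if g: "g \<in> ?S" for g k
  proof -
    obtain "is" where g: "g = (\<lambda>t. pderivs is f (t - c))" using g by blast
    obtain C where C: "0 \<le> C" "\<And>x. norm (pderivs is f x) \<le> C / (1 + norm x) ^ k"
      using schwartz_decay[OF schwartz_pderivs[OF f]] by metis
    have "norm x ^ k * norm (g x) \<le> (1 + norm c) ^ k * C" for x
    proof -
      have "norm x \<le> norm (x - c) + norm c" by (metis norm_triangle_sub add.commute)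
      also have "\<dots> \<le> (1 + norm c) * (1 + norm (x - c))"
        by (simp add: distrib_left distrib_right)
      finally have "norm x ^ k \<le> ((1 + norm c) * (1 + norm (x - c))) ^ k"
        by (intro power_mono) auto
      then have "norm x ^ k * norm (g x) \<le> ((1 + norm c) * (1 + norm (x - c))) ^ k * (C / (1 + norm (x - c)) ^ k)"
        unfolding g using C by (intro mult_mono) auto
      also have "\<dots> = (1 + norm c) ^ k * C"
      proof -
        have "1 + norm (x - c) \<noteq> 0" using norm_ge_zero[of "x - c"] by linarith
        then show ?thesis by (simp add: power_mult_distrib)
      qed
      finally show ?thesis .
    qed
    then show ?thesis unfolding bounded_iff by (auto simp: abs_mult)
  qed
qed

section \<open>The transform of the window near the origin\<close>

lemma stft_sequence_tendsto:
  fixes \<gamma> :: "real^'n::finite \<Rightarrow> complex"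
  assumes \<gamma>: "schwartz \<gamma>" and X: "X \<longlonglongrightarrow> 0" and Y: "Y \<longlonglongrightarrow> 0"
  shows "(\<lambda>j. stft \<gamma> \<gamma> (X j) (Y j)) \<longlonglongrightarrow> stft \<gamma> \<gamma> 0 0"
proof -
  note [measurable] = schwartz_measurable[OF \<gamma>]
  obtain C where C: "\<And>x t. norm (\<gamma> t * cnj (\<gamma> (t - x))) \<le> C / ((1 + norm t) ^ (CARD('n) + 2) * (1 + norm x) ^ 0)"
    using stft_bound[OF \<gamma> \<gamma>] by metis
  show ?thesis
    unfolding stft_def
  proof (rule integral_dominated_convergence)
    show "integrable lborel (\<lambda>t::real^'n. C * (1 / (1 + norm t) ^ (CARD('n) + 2)))"
      by (intro integrable_mult_right integrable_inverse_power_norm)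
    show "AE t in lborel. norm (\<gamma> t * cnj (cis (Y j \<bullet> t) * \<gamma> (t - X j))) \<le> C * (1 / (1 + norm t) ^ (CARD('n) + 2))" for j
      using C[of _ "X j"] unfolding norm_mult complex_mod_cnj norm_cis power_0 mult_1 mult_1_right times_divide_eq_right
      by (intro AE_I2)
    have "isCont \<gamma> t" for t
      using schwartz_continuous[OF \<gamma>] by (simp add: continuous_on_eq_continuous_at)
    then have g: "(\<lambda>j. \<gamma> (t - X j)) \<longlonglongrightarrow> \<gamma> (t - 0)" for t
      by (rule isCont_tendsto_compose) (intro tendsto_intros X)
    have c: "(\<lambda>j. cis (Y j \<bullet> t)) \<longlonglongrightarrow> cis (0 \<bullet> t)" for t
      unfolding cis_conv_exp by (intro tendsto_intros Y)
    show "AE t in lborel. (\<lambda>j. \<gamma> t * cnj (cis (Y j \<bullet> t) * \<gamma> (t - X j))) \<longlonglongrightarrow> \<gamma> t * cnj (cis (0 \<bullet> t) * \<gamma> (t - 0))"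
      by (intro AE_I2 tendsto_mult tendsto_cnj tendsto_const g c)
  qed measurable
qed

text \<open>The value is the integral of the squared modulus of \<gamma>. If it vanished, the open
  set where \<gamma> is nonzero would be a null set, hence empty.\<close>

lemma stft_self_nonzero:
  fixes \<gamma> :: "real^'n::finite \<Rightarrow> complex"
  assumes \<gamma>: "schwartz \<gamma>" "\<gamma> \<noteq> (\<lambda>_. 0)"
  shows "stft \<gamma> \<gamma> 0 0 \<noteq> 0"
proof
  assume "stft \<gamma> \<gamma> 0 0 = 0"
  moreover have eq: "\<gamma> t * cnj (cis (0 \<bullet> t) * \<gamma> (t - 0)) = of_real ((norm (\<gamma> t))\<^sup>2)" for t
    using complex_norm_square[of "\<gamma> t"] by simp
  ultimately have "(LINT t|lborel. (norm (\<gamma> t))\<^sup>2) = 0"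
    unfolding stft_def by (simp only: integral_complex_of_real of_real_eq_0_iff)
  moreover have "integrable lborel (\<lambda>t. (norm (\<gamma> t))\<^sup>2)"
    using stft_integrable[OF \<gamma>(1) \<gamma>(1), of 0 0] unfolding eq by (simp only: complex_of_real_integrable_eq)
  ultimately have "AE t in lborel. (norm (\<gamma> t))\<^sup>2 = 0"
    by (subst (asm) integral_nonneg_eq_0_iff_AE) auto
  then have "AE t in lborel. t \<notin> {t. \<gamma> t \<noteq> 0}" by simp
  moreover have op: "open {t. \<gamma> t \<noteq> 0}"
    using schwartz_continuous[OF \<gamma>(1)] by (intro open_Collect_neq) auto
  ultimately have "{t. \<gamma> t \<noteq> 0} \<in> null_sets lborel"
    by (subst (asm) AE_iff_null_sets[symmetric]) auto
  then have "negligible {t. \<gamma> t \<noteq> 0}"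
    unfolding negligible_iff_null_sets by (rule null_sets_completionI)
  then have "{t. \<gamma> t \<noteq> 0} = {}"
    using open_not_negligible[OF op] by blast
  then show False using \<gamma>(2) by auto
qed

lemma stft_self_lower_bound:
  fixes \<gamma> :: "real^'n::finite \<Rightarrow> complex"
  assumes \<gamma>: "schwartz \<gamma>" "\<gamma> \<noteq> (\<lambda>_. 0)"
  obtains b \<delta> where "0 < b" "0 < \<delta>" "\<delta> \<le> 1"
    "\<And>x \<xi>. norm x < \<delta> \<Longrightarrow> norm \<xi> < \<delta> \<Longrightarrow> 2 * b \<le> norm (stft \<gamma> \<gamma> x \<xi>)"
proof -
  \<comment> \<open>The value at the origin has modulus 4 * b. Half of it survives nearby by
    continuity, and half of that will be spent on the tails of other frequencies.\<close>
  define b where "b = norm (stft \<gamma> \<gamma> 0 0) / 4"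
  have b: "0 < b" using stft_self_nonzero[OF \<gamma>] by (simp add: b_def)
  have "\<exists>j. \<forall>x \<xi>. norm x < 1 / (1 + real j) \<longrightarrow> norm \<xi> < 1 / (1 + real j) \<longrightarrow> 2 * b \<le> norm (stft \<gamma> \<gamma> x \<xi>)"
  proof (rule ccontr)
    assume "\<not> ?thesis"
    then obtain X Y where XY: "\<And>j. norm (X j) < 1 / (1 + real j)" "\<And>j. norm (Y j) < 1 / (1 + real j)"
      "\<And>j. norm (stft \<gamma> \<gamma> (X j) (Y j)) < 2 * b"
      by (metis linorder_not_le)
    have 0: "(\<lambda>j. 1 / (1 + real j)) \<longlonglongrightarrow> 0"
      using LIMSEQ_inverse_real_of_nat by (simp add: inverse_eq_divide)
    have "X \<longlonglongrightarrow> 0" "Y \<longlonglongrightarrow> 0"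
      by (rule Lim_null_comparison[OF _ 0]; use XY in \<open>auto intro!: always_eventually less_imp_le\<close>)+
    then have "(\<lambda>j. norm (stft \<gamma> \<gamma> (X j) (Y j))) \<longlonglongrightarrow> norm (stft \<gamma> \<gamma> 0 0)"
      by (intro tendsto_norm stft_sequence_tendsto \<gamma>)
    then have "norm (stft \<gamma> \<gamma> 0 0) \<le> 2 * b"
      by (rule tendsto_upperbound) (use XY(3) in \<open>auto intro!: always_eventually less_imp_le\<close>)
    then show False using b by (simp add: b_def)
  qed
  then obtain j where "\<And>x \<xi>. norm x < 1 / (1 + real j) \<Longrightarrow> norm \<xi> < 1 / (1 + real j) \<Longrightarrow> 2 * b \<le> norm (stft \<gamma> \<gamma> x \<xi>)"
    by blast
  then show thesis using that[of b "1 / (1 + real j)"] b by simp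
qed

section \<open>Upper and lower bounds for mixed norms\<close>

abbreviation lborel_weight :: "'n::finite itself \<Rightarrow> real" where
  "lborel_weight _ \<equiv> LINT x|lborel. 1 / (1 + norm (x::real^'n)) ^ (CARD('n) + 2)"

lemma nn_integral_weight:
  assumes "0 \<le> c"
  shows "(\<integral>\<^sup>+ x. ennreal (c * (1 / (1 + norm (x::real^'n::finite)) ^ (CARD('n) + 2))) \<partial>lborel)
    = ennreal (c * lborel_weight TYPE('n))"
proof -
  have "(\<integral>\<^sup>+ x. ennreal (c * (1 / (1 + norm (x::real^'n)) ^ (CARD('n) + 2))) \<partial>lborel)
    = ennreal (LINT x|lborel. c * (1 / (1 + norm (x::real^'n)) ^ (CARD('n) + 2)))"
    using assms by (intro nn_integral_eq_integral integrable_mult_right integrable_inverse_power_norm)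
      (auto intro!: AE_I2 mult_nonneg_nonneg divide_nonneg_nonneg)
  then show ?thesis by (simp only: integral_mult_right_zero)
qed

lemma lborel_weight_nonneg: "0 \<le> lborel_weight TYPE('n::finite)"
  by (intro integral_nonneg_AE AE_I2 divide_nonneg_nonneg) auto

text \<open>The weight in x lies between 0 and 1 and p is at least 1, so its p-th power is bounded
  by the weight itself. One integrable weight thus serves every p.\<close>

lemma mixed_le:
  fixes V :: "real^'n::finite \<Rightarrow> real^'n \<Rightarrow> complex"
  assumes pq: "1 \<le> p" "0 < q" and a: "0 \<le> a" and G: "\<And>\<xi>. 0 \<le> G \<xi>"
    and [measurable]: "G \<in> borel_measurable borel"
    and V: "\<And>x \<xi>. norm (V x \<xi>) \<le> a * G \<xi> * (1 / (1 + norm x) ^ (CARD('n) + 2))"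
  shows "mixed p q V \<le> ennreal (a powr q * lborel_weight TYPE('n) powr (q / p)) * (\<integral>\<^sup>+ \<xi>. ennreal (G \<xi> powr q) \<partial>lborel)"
proof -
  let ?I = "lborel_weight TYPE('n)"
  have "ennpow (\<integral>\<^sup>+ x. ennreal (norm (V x \<xi>) powr p) \<partial>lborel) (q / p)
      \<le> ennreal (a powr q * ?I powr (q / p)) * ennreal (G \<xi> powr q)" for \<xi>
  proof -
    let ?c = "(a * G \<xi>) powr p"
    have "norm (V x \<xi>) powr p \<le> ?c * (1 / (1 + norm x) ^ (CARD('n) + 2))" for x
    proof -
      let ?w = "1 / (1 + norm x) ^ (CARD('n) + 2)"
      have "1 \<le> (1 + norm x) ^ (CARD('n) + 2)" by (rule one_le_power) simp
      then have w: "0 < ?w" "?w \<le> 1" by (simp_all only: divide_le_eq_1 zero_less_divide_1_iff) auto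
      have "norm (V x \<xi>) powr p \<le> (a * G \<xi> * ?w) powr p"
        using pq V by (intro powr_mono2) auto
      also have "\<dots> = ?c * ?w powr p"
        by (rule powr_mult)
      also have "\<dots> \<le> ?c * ?w powr 1"
        using pq(1) w by (intro mult_left_mono powr_mono') auto
      finally show ?thesis using w(1) by (simp only: powr_one)
    qed
    then have "(\<integral>\<^sup>+ x. ennreal (norm (V x \<xi>) powr p) \<partial>lborel)
        \<le> (\<integral>\<^sup>+ x. ennreal (?c * (1 / (1 + norm (x::real^'n)) ^ (CARD('n) + 2))) \<partial>lborel)"
      by (intro nn_integral_mono ennreal_leI)
    also have "\<dots> = ennreal (?c * ?I)"
      by (rule nn_integral_weight) simp
    finally have "ennpow (\<integral>\<^sup>+ x. ennreal (norm (V x \<xi>) powr p) \<partial>lborel) (q / p) \<le> ennpow (ennreal (?c * ?I)) (q / p)"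
      using pq by (intro ennpow_mono) auto
    also have "\<dots> = ennreal ((?c * ?I) powr (q / p))"
      by (intro ennpow_ennreal mult_nonneg_nonneg lborel_weight_nonneg) simp
    also have "(?c * ?I) powr (q / p) = (a powr q * ?I powr (q / p)) * G \<xi> powr q"
    proof -
      have "(?c * ?I) powr (q / p) = ?c powr (q / p) * ?I powr (q / p)"
        by (rule powr_mult)
      also have "?c powr (q / p) = a powr q * G \<xi> powr q"
        using pq a G by (simp add: powr_powr powr_mult)
      finally show ?thesis by (simp only: mult_ac)
    qed
    finally show ?thesis by (simp add: ennreal_mult)
  qed
  then have "mixed p q V \<le> (\<integral>\<^sup>+ \<xi>. ennreal (a powr q * ?I powr (q / p)) * ennreal (G \<xi> powr q) \<partial>lborel)"
    unfolding mixed_def by (intro nn_integral_mono)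
  also have "\<dots> = ennreal (a powr q * ?I powr (q / p)) * (\<integral>\<^sup>+ \<xi>. ennreal (G \<xi> powr q) \<partial>lborel)"
    by (rule nn_integral_cmult) measurable
  finally show ?thesis .
qed

text \<open>The integral in x is restricted to a ball, which accounts for the power q / p of its
  volume, and the integral in \<xi> to E, whose measure enters linearly.\<close>

lemma mixed_ge:
  fixes V :: "real^'n::finite \<Rightarrow> real^'n \<Rightarrow> complex"
  assumes pq: "0 < p" "0 < q" and a: "0 \<le> a"
    and E: "E \<in> sets borel"
    and V: "\<And>x \<xi>. norm x < \<delta> \<Longrightarrow> \<xi> \<in> E \<Longrightarrow> a \<le> norm (V x \<xi>)"
  shows "ennreal (a powr q * measure lborel (ball (0::real^'n) \<delta>) powr (q / p)) * emeasure lborel E \<le> mixed p q V"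
proof -
  let ?v = "measure lborel (ball (0::real^'n) \<delta>)"
  have ev: "emeasure lborel (ball (0::real^'n) \<delta>) = ennreal ?v"
    using emeasure_bounded_finite[OF bounded_ball[of "0::real^'n" \<delta>]] by (intro emeasure_eq_ennreal_measure) auto
  have "ennreal (a powr q * ?v powr (q / p)) * indicator E \<xi> \<le> ennpow (\<integral>\<^sup>+ x. ennreal (norm (V x \<xi>) powr p) \<partial>lborel) (q / p)" for \<xi>
  proof (cases "\<xi> \<in> E")
    case True
    have "ennreal (a powr p * ?v) = (\<integral>\<^sup>+ x. ennreal (a powr p) * indicator (ball (0::real^'n) \<delta>) x \<partial>lborel)"
      by (subst nn_integral_cmult_indicator) (simp_all add: ev ennreal_mult)
    also have "\<dots> \<le> (\<integral>\<^sup>+ x. ennreal (norm (V x \<xi>) powr p) \<partial>lborel)"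
      using a pq V[OF _ True] by (intro nn_integral_mono) (auto simp: indicator_def intro!: ennreal_leI powr_mono2)
    finally have "ennpow (ennreal (a powr p * ?v)) (q / p) \<le> ennpow (\<integral>\<^sup>+ x. ennreal (norm (V x \<xi>) powr p) \<partial>lborel) (q / p)"
      using pq by (intro ennpow_mono) auto
    moreover have "ennpow (ennreal (a powr p * ?v)) (q / p) = ennreal (a powr q * ?v powr (q / p))"
      using pq a by (simp add: ennpow_ennreal powr_mult powr_powr)
    ultimately show ?thesis using True by simp
  qed simp
  then have "(\<integral>\<^sup>+ \<xi>. ennreal (a powr q * ?v powr (q / p)) * indicator E \<xi> \<partial>lborel) \<le> mixed p q V"
    unfolding mixed_def by (intro nn_integral_mono)
  then show ?thesis
    using E by (subst (asm) nn_integral_cmult_indicator) auto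
qed

lemma stft_modulations:
  fixes \<gamma> :: "real^'n::finite \<Rightarrow> complex"
  assumes \<gamma>: "schwartz \<gamma>"
  shows "stft \<gamma> (\<lambda>t. (\<Sum>j\<in>J. c j * cis (a j \<bullet> t)) * \<gamma> t) x \<xi> = (\<Sum>j\<in>J. c j * stft \<gamma> \<gamma> x (\<xi> - a j))"
proof -
  let ?h = "\<lambda>j t. \<gamma> t * cnj (cis ((\<xi> - a j) \<bullet> t) * \<gamma> (t - x))"
  have "(\<Sum>j\<in>J. c j * cis (a j \<bullet> t)) * \<gamma> t * cnj (cis (\<xi> \<bullet> t) * \<gamma> (t - x)) = (\<Sum>j\<in>J. c j * ?h j t)" for t
  proof -
    have "cnj (cis ((\<xi> - a j) \<bullet> t)) = cnj (cis (\<xi> \<bullet> t)) * cis (a j \<bullet> t)" for j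
      by (simp add: cis_cnj cis_mult inner_diff_left)
    then show ?thesis
      unfolding sum_distrib_right complex_cnj_mult by (simp only: mult_ac)
  qed
  then have "stft \<gamma> (\<lambda>t. (\<Sum>j\<in>J. c j * cis (a j \<bullet> t)) * \<gamma> t) x \<xi> = (LINT t|lborel. (\<Sum>j\<in>J. c j * ?h j t))"
    unfolding stft_def by simp
  also have "\<dots> = (\<Sum>j\<in>J. LINT t|lborel. c j * ?h j t)"
    by (intro Bochner_Integration.integral_sum integrable_mult_right stft_integrable \<gamma>)
  finally show ?thesis unfolding stft_def by simp
qed

text \<open>The frequency \<open>\<omega>\<close> dominates near itself, since all other frequencies are at distance at least \<open>R\<close>.\<close>
lemma stft_modulations_lower_bound:
  fixes \<gamma> :: "real^'n::finite \<Rightarrow> complex"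
  assumes \<gamma>: "schwartz \<gamma>" and J: "finite J"
    and K: "0 < K" "\<And>x \<xi>. norm (stft \<gamma> \<gamma> x \<xi>) \<le> K / (1 + norm \<xi>)"
    and \<delta>: "\<delta> \<le> 1" and b: "\<And>x \<xi>. norm x < \<delta> \<Longrightarrow> norm \<xi> < \<delta> \<Longrightarrow> 2 * b \<le> norm (stft \<gamma> \<gamma> x \<xi>)"
    and R: "0 < R" "\<And>j. j \<in> J \<Longrightarrow> a j \<noteq> \<omega> \<Longrightarrow> R \<le> norm (a j - \<omega>)"
    and \<beta>: "0 \<le> b" "\<beta> \<le> norm (\<Sum>j\<in>{j\<in>J. a j = \<omega>}. c j)" "(\<Sum>j\<in>J. norm (c j)) * (K / R) \<le> b * \<beta>"
    and x: "norm x < \<delta>" "norm (\<xi> - \<omega>) < \<delta>"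
  shows "b * \<beta> \<le> norm (stft \<gamma> (\<lambda>t. (\<Sum>j\<in>J. c j * cis (a j \<bullet> t)) * \<gamma> t) x \<xi>)"
proof -
  \<comment> \<open>Indices with the same frequency are grouped: in the product of a comb with its
    conjugate, all diagonal pairs meet at frequency 0.\<close>
  let ?J0 = "{j\<in>J. a j = \<omega>}" and ?J1 = "{j\<in>J. a j \<noteq> \<omega>}"
  let ?V = "\<lambda>j. stft \<gamma> \<gamma> x (\<xi> - a j)"
  have split: "(\<Sum>j\<in>J. c j * ?V j) = (\<Sum>j\<in>?J0. c j * ?V j) + (\<Sum>j\<in>?J1. c j * ?V j)"
    by (subst sum.union_disjoint[symmetric]) (use J in \<open>auto intro!: sum.cong\<close>)
  have "(\<Sum>j\<in>?J0. c j * ?V j) = (\<Sum>j\<in>?J0. c j) * stft \<gamma> \<gamma> x (\<xi> - \<omega>)"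
    by (simp add: sum_distrib_right)
  then have "\<beta> * (2 * b) \<le> norm (\<Sum>j\<in>?J0. c j * ?V j)"
    using \<beta> b[OF x] by (simp only: norm_mult) (intro mult_mono; simp)
  then have "2 * (b * \<beta>) \<le> norm (\<Sum>j\<in>?J0. c j * ?V j)"
    by (simp only: mult_ac)
  moreover have "norm (\<Sum>j\<in>?J1. c j * ?V j) \<le> b * \<beta>"
  proof -
    have "norm (c j * ?V j) \<le> norm (c j) * (K / R)" if "j \<in> ?J1" for j
    proof -
      have "norm (a j - \<omega>) \<le> norm (\<xi> - a j) + norm (\<xi> - \<omega>)"
        using norm_triangle_ineq4[of "\<xi> - \<omega>" "\<xi> - a j"] by simp
      \<comment> \<open>The distance from \<xi> to \<omega> is below \<delta> \<le> 1, so the 1 in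
        the denominator of the decay bound absorbs it.\<close>
      then have "R \<le> 1 + norm (\<xi> - a j)"
        using R(2)[of j] that x(2) \<delta> by auto
      then have "K / (1 + norm (\<xi> - a j)) \<le> K / R"
        using K(1) R(1) by (intro divide_left_mono mult_pos_pos) auto
      then show ?thesis
        unfolding norm_mult by (intro mult_left_mono order_trans[OF K(2)]) auto
    qed
    then have "norm (\<Sum>j\<in>?J1. c j * ?V j) \<le> (\<Sum>j\<in>?J1. norm (c j) * (K / R))"
      by (rule sum_norm_le)
    also have "\<dots> \<le> (\<Sum>j\<in>J. norm (c j) * (K / R))"
      using J K(1) R(1) by (intro sum_mono2) auto
    also have "\<dots> \<le> b * \<beta>"
      using \<beta>(3) by (simp only: sum_distrib_right)
    finally show ?thesis .
  qed
  ultimately show ?thesis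
    unfolding stft_modulations[OF \<gamma>] split
    using norm_diff_ineq[of "\<Sum>j\<in>?J0. c j * ?V j" "\<Sum>j\<in>?J1. c j * ?V j"] by linarith
qed

section \<open>Bounded multipliers\<close>

lemma CZO_multiplication:
  fixes m :: "real^'n::finite \<Rightarrow> complex"
  assumes [measurable]: "m \<in> borel_measurable borel" and m: "\<And>x. norm (m x) \<le> 1"
  shows "CZO (\<lambda>f x. m x * f x) (\<lambda>_ _. 0)"
proof -
  have le: "(norm (m x * f x))\<^sup>2 \<le> (norm (f x))\<^sup>2" for f :: "real^'n \<Rightarrow> complex" and x
    unfolding norm_mult using m by (intro power_mono mult_left_le_one_le) auto
  have sq: "sq_int (\<lambda>x. m x * f x)" if "sq_int f" for f
  proof -
    have [measurable]: "f \<in> borel_measurable lborel" and i: "integrable lborel (\<lambda>x. (norm (f x))\<^sup>2)"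
      using that unfolding sq_int_def by auto
    have "integrable lborel (\<lambda>x. (norm (m x * f x))\<^sup>2)"
      by (rule Bochner_Integration.integrable_bound[OF i]) (use le in auto)
    moreover have "(\<lambda>x. m x * f x) \<in> borel_measurable lborel" by measurable
    ultimately show ?thesis unfolding sq_int_def by simp
  qed
  have L2: "L2norm (\<lambda>x. m x * f x) \<le> 1 * L2norm f" if "sq_int f" for f
    using sq[OF that] that le unfolding L2norm_def sq_int_def
    by (simp add: integral_mono)
  have zero: "m x * \<phi> x * \<psi> x = 0" if "tsupp \<phi> \<inter> tsupp \<psi> = {}" for \<phi> \<psi> x
  proof -
    have "x \<in> tsupp \<phi>" if "\<phi> x \<noteq> 0" for \<phi>
      using that closure_subset[THEN subsetD, of x "{x. \<phi> x \<noteq> 0}"] by (simp add: tsupp_def)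
    then show ?thesis using that by (auto simp: disjoint_iff)
  qed
  have kernel: "(LINT x|lborel. m x * \<phi> x * \<psi> x) = (LINT x|lborel. LINT y|lborel. 0 * \<phi> y * \<psi> x)"
    if "tsupp \<phi> \<inter> tsupp \<psi> = {}" for \<phi> \<psi>
    unfolding zero[OF that] by simp
  show ?thesis
    unfolding CZO_def
  proof (intro conjI)
    show "\<forall>f g a b. sq_int f \<longrightarrow> sq_int g \<longrightarrow>
        (AE x in lborel. m x * (a * f x + b * g x) = a * (m x * f x) + b * (m x * g x))"
      by (auto simp: algebra_simps)
    show "\<exists>C. \<forall>f. sq_int f \<longrightarrow> sq_int (\<lambda>x. m x * f x) \<and> L2norm (\<lambda>x. m x * f x) \<le> C * L2norm f"
      using sq L2 by blast
    show "\<exists>eps C. 0 < eps \<and> eps \<le> 1 \<and> 0 < C \<and>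
        (\<forall>x y. x \<noteq> y \<longrightarrow> norm (0::complex) \<le> C * norm (x - y :: real^'n) powr (- real CARD('n))) \<and>
        (\<forall>x x' y. x \<noteq> y \<longrightarrow> norm (x - y) > 2 * norm (x - x') \<longrightarrow>
           norm (0 - 0 :: complex) \<le> C * norm (x - x' :: real^'n) powr eps * norm (x - y) powr (- real CARD('n) - eps)) \<and>
        (\<forall>x y y'. x \<noteq> y \<longrightarrow> norm (x - y) > 2 * norm (y - y') \<longrightarrow>
           norm (0 - 0 :: complex) \<le> C * norm (y - y' :: real^'n) powr eps * norm (x - y) powr (- real CARD('n) - eps))"
      by (intro exI[of _ 1]) simp
  qed (use kernel in \<open>auto simp: split_beta'\<close>)
qed

text \<open>Eventual equality at each single point is what the glued multiplier provides after
  translation. The bound by 1 supplies the majorant for dominated convergence.\<close>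

lemma stft_tendsto_of_multipliers:
  fixes f \<gamma> :: "real^'n::finite \<Rightarrow> complex"
  assumes f: "schwartz f" and \<gamma>: "schwartz \<gamma>"
    and [measurable]: "\<And>r. g r \<in> borel_measurable borel" "h \<in> borel_measurable borel"
    and g: "\<And>r t. norm (g r t) \<le> 1" and lim: "\<And>t. \<forall>\<^sub>F r in sequentially. g r t = h t"
  shows "(\<lambda>r. stft \<gamma> (\<lambda>t. g r t * f t) x \<xi>) \<longlonglongrightarrow> stft \<gamma> (\<lambda>t. h t * f t) x \<xi>"
proof -
  note [measurable] = schwartz_measurable[OF f] schwartz_measurable[OF \<gamma>]
  show ?thesis
    unfolding stft_def
  proof (rule integral_dominated_convergence)
    show "integrable lborel (\<lambda>t. norm (f t * cnj (cis (\<xi> \<bullet> t) * \<gamma> (t - x))))"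
      by (intro integrable_norm stft_integrable f \<gamma>)
    show "AE t in lborel. (\<lambda>r. g r t * f t * cnj (cis (\<xi> \<bullet> t) * \<gamma> (t - x))) \<longlonglongrightarrow> h t * f t * cnj (cis (\<xi> \<bullet> t) * \<gamma> (t - x))"
      by (intro AE_I2 tendsto_mult tendsto_const tendsto_eventually lim)
    show "AE t in lborel. norm (g r t * f t * cnj (cis (\<xi> \<bullet> t) * \<gamma> (t - x))) \<le> norm (f t * cnj (cis (\<xi> \<bullet> t) * \<gamma> (t - x)))" for r
      using g unfolding mult.assoc norm_mult[of "g _ _"] by (intro AE_I2 mult_left_le_one_le) auto
  qed measurable
qed

text \<open>The multiplier \<open>m\<close> carries a copy of every \<open>mm j\<close> on arbitrarily wide slabs; index \<open>l\<close> encodes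
  the pair of \<open>j\<close> and a counter, and the slab \<open>l\<^sup>2 \<le> \<bar>x\<^sub>1\<bar> < (l + 1)\<^sup>2\<close> is centred at \<open>l\<^sup>2 + l\<close>.\<close>
lemma gluing:
  fixes \<gamma> :: "real^'n::finite \<Rightarrow> complex" and mm :: "nat \<Rightarrow> real^'n \<Rightarrow> complex"
  assumes pq: "0 < p" "0 < q" and \<gamma>: "schwartz \<gamma>"
    and mm[measurable]: "\<And>j. mm j \<in> borel_measurable borel" and mm1: "\<And>j x. norm (mm j x) \<le> 1"
  obtains m where "m \<in> borel_measurable borel" "\<And>x. norm (m x) \<le> 1"
    "\<forall>C j f. schwartz f \<longrightarrow>
      (\<forall>g. schwartz g \<longrightarrow> mixed p q (stft \<gamma> (\<lambda>x. m x * g x)) \<le> C * mixed p q (stft \<gamma> g)) \<longrightarrow>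
      mixed p q (stft \<gamma> (\<lambda>x. mm j x * f x)) \<le> C * mixed p q (stft \<gamma> f)"
proof -
  note [measurable] = schwartz_measurable[OF \<gamma>]
  define e where "e = (axis undefined 1 :: real^'n)"
  define c where "c l = (real l ^ 2 + real l) *\<^sub>R e" for l :: nat
  define idx where "idx x = nat \<lfloor>sqrt \<bar>e \<bullet> x\<bar>\<rfloor>" for x :: "real^'n"
  define m where "m x = mm (fst (prod_decode (idx x))) (x - c (idx x))" for x
  have [measurable]: "idx \<in> measurable borel (count_space UNIV)"
    unfolding idx_def by measurable
  have m_meas[measurable]: "m \<in> borel_measurable borel"
    unfolding m_def by (rule measurable_compose_countable[where g = idx]) measurable
  \<comment> \<open>From the centre l^2 + l the lower end of the slab is at distance l and the upper
    end at distance l + 1, so a displacement smaller than l stays inside.\<close>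
  have idx: "idx (t + c l) = l" if "\<bar>e \<bullet> t\<bar> < real l" for t l
  proof -
    have "e \<bullet> (t + c l) = e \<bullet> t + (real l ^ 2 + real l)"
      by (simp add: c_def e_def inner_add_right inner_axis_axis)
    then have "real l ^ 2 \<le> e \<bullet> (t + c l)" "e \<bullet> (t + c l) < (real l + 1) ^ 2"
      using that unfolding power2_sum by auto
    then have "real l ^ 2 \<le> \<bar>e \<bullet> (t + c l)\<bar>" "\<bar>e \<bullet> (t + c l)\<bar> < (real l + 1) ^ 2"
      using zero_le_power2[of "real l"] by linarith+
    then have "real l \<le> sqrt \<bar>e \<bullet> (t + c l)\<bar>" "sqrt \<bar>e \<bullet> (t + c l)\<bar> < real l + 1"
      by (auto intro!: real_le_rsqrt real_less_lsqrt)
    then have "\<lfloor>sqrt \<bar>e \<bullet> (t + c l)\<bar>\<rfloor> = int l"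
      by (intro floor_unique) auto
    then show ?thesis by (simp add: idx_def)
  qed
  show thesis
  proof (rule that[OF m_meas], goal_cases)
    case 1
    show ?case by (simp add: m_def mm1)
  next
    case 2
    show ?case
    proof (intro allI impI)
      fix C j and f :: "real^'n \<Rightarrow> complex"
      assume f: "schwartz f"
        and bound: "\<forall>g. schwartz g \<longrightarrow> mixed p q (stft \<gamma> (\<lambda>x. m x * g x)) \<le> C * mixed p q (stft \<gamma> g)"
      note [measurable] = schwartz_measurable[OF f]
      \<comment> \<open>For fixed j the slab numbers \<open>prod_encode (j, r)\<close> are at least
        r, so \<open>mm j\<close> occurs on slabs of unbounded width.\<close>
      define l where "l r = prod_encode (j, r)" for r
      let ?g = "\<lambda>r t. m (t + c (l r))"
      have ev: "\<forall>\<^sub>F r in sequentially. ?g r t = mm j t" for t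
      proof -
        obtain r0 where r0: "\<bar>e \<bullet> t\<bar> < real r0" using reals_Archimedean2 by blast
        have "?g r t = mm j t" if "r0 \<le> r" for r
        proof -
          have "r \<le> l r" unfolding l_def by (rule le_prod_encode_2)
          then have "idx (t + c (l r)) = l r" using r0 that by (intro idx) linarith
          then show ?thesis by (simp add: m_def l_def)
        qed
        then show ?thesis unfolding eventually_sequentially by blast
      qed
      have g_le: "mixed p q (stft \<gamma> (\<lambda>t. ?g r t * f t)) \<le> C * mixed p q (stft \<gamma> f)" for r
      proof -
        have "mixed p q (stft \<gamma> (\<lambda>t. ?g r t * f t)) = mixed p q (stft \<gamma> (\<lambda>t. m t * f (t - c (l r))))"
          using mixed_stft_translate[of "\<lambda>t. ?g r t * f t" \<gamma> p q "c (l r)"] by simp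
        also have "\<dots> \<le> C * mixed p q (stft \<gamma> (\<lambda>t. f (t - c (l r))))"
          by (intro bound[rule_format] schwartz_translate f)
        also have "\<dots> = C * mixed p q (stft \<gamma> f)"
          by (simp add: mixed_stft_translate)
        finally show ?thesis .
      qed
      have "mixed p q (stft \<gamma> (\<lambda>t. mm j t * f t)) \<le> liminf (\<lambda>r. mixed p q (stft \<gamma> (\<lambda>t. ?g r t * f t)))"
        by (intro mixed_fatou pq stft_measurable stft_tendsto_of_multipliers f \<gamma> ev)
           (auto simp: m_def mm1)
      also have "\<dots> \<le> C * mixed p q (stft \<gamma> f)"
        by (intro Liminf_le always_eventually allI g_le trivial_limit_sequentially)
      finally show "mixed p q (stft \<gamma> (\<lambda>x. mm j x * f x)) \<le> C * mixed p q (stft \<gamma> f)" .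
    qed
  qed
qed

section \<open>Sums of widely spaced modulations\<close>

text \<open>The frequencies form an arithmetic progression on one axis. A sum of the corresponding
  exponentials is then a polynomial in a single unimodular variable, to which the Rudin-Shapiro
  bound applies.\<close>

definition comb :: "real \<Rightarrow> nat \<Rightarrow> real^'n::finite" where
  "comb R k = (R * real k) *\<^sub>R axis undefined 1"

lemma norm_comb_diff: "0 \<le> R \<Longrightarrow> norm (comb R k - comb R l :: real^'n::finite) = R * \<bar>real k - real l\<bar>"
  by (simp add: comb_def scaleR_diff_left[symmetric] norm_axis_1 right_diff_distrib[symmetric] abs_mult)

lemma norm_comb_diff_ge:
  assumes "0 \<le> R" "k \<noteq> l" shows "R \<le> norm (comb R k - comb R l :: real^'n::finite)"
proof -
  have "1 \<le> \<bar>real k - real l\<bar>" using assms(2) by linarith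
  then show ?thesis
    using mult_left_mono[OF _ assms(1)] by (fastforce simp: norm_comb_diff assms)
qed

lemma comb_eq_iff: "0 < R \<Longrightarrow> (comb R k :: real^'n::finite) = comb R l \<longleftrightarrow> k = l"
  using norm_comb_diff_ge[of R k l, where 'n = 'n] by (cases "k = l") auto

text \<open>The sum G of the translated weights is at most 3, so G^q is at most 3^(q - 1) G, whose
  integral is linear in N. The number of frequencies therefore enters to the first power, next to
  s^q.\<close>

lemma mixed_comb_le:
  fixes \<gamma> :: "real^'n::finite \<Rightarrow> complex"
  assumes pq: "1 \<le> p" "1 \<le> q" and \<gamma>: "schwartz \<gamma>"
    and K: "0 \<le> K" "\<And>x \<xi>. norm (stft \<gamma> \<gamma> x \<xi>) \<le> K / ((1 + norm x) ^ (CARD('n) + 2) * (1 + norm \<xi>) ^ (CARD('n) + 2))"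
    and R: "0 < R" "real N \<le> R" and c: "\<And>k. norm (c k) \<le> s"
  shows "mixed p q (stft \<gamma> (\<lambda>t. (\<Sum>k<N. c k * cis (comb R k \<bullet> t)) * \<gamma> t))
    \<le> ennreal ((K * s) powr q * lborel_weight TYPE('n) powr (q / p) * (3 powr (q - 1) * (real N * lborel_weight TYPE('n))))"
proof -
  let ?M = "CARD('n) + 2"
  let ?w = "\<lambda>\<xi>::real^'n. 1 / (1 + norm \<xi>) ^ ?M"
  define G where "G \<xi> = (\<Sum>k<N. ?w (\<xi> - comb R k))" for \<xi> :: "real^'n"
  have s: "0 \<le> s" using order_trans[OF norm_ge_zero c] .
  have w: "0 \<le> ?w \<xi>" for \<xi> by (intro divide_nonneg_nonneg zero_le_power add_nonneg_nonneg) auto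
  have G0: "0 \<le> G \<xi>" for \<xi> unfolding G_def by (intro sum_nonneg w)
  have wM: "?w \<in> borel_measurable borel"
    using borel_measurable_integrable[OF integrable_inverse_power_norm] by simp
  have wMk: "(\<lambda>\<xi>. ?w (\<xi> - comb R k)) \<in> borel_measurable borel" for k
    by (rule measurable_compose[OF _ wM]) measurable
  have GM[measurable]: "G \<in> borel_measurable borel"
    unfolding G_def by (intro borel_measurable_sum wMk)
  \<comment> \<open>At most one comb point lies within R / 2 of \<xi>, and it contributes at most 1
    beyond the common bound 2 / R. The N bounds 2 / R add up to at most 2 because N \<le> R.\<close>
  have G3: "G \<xi> \<le> 3" for \<xi>
  proof -
    let ?near = "{k. k < N \<and> norm (\<xi> - comb R k) < R / 2}"
    have "?w (\<xi> - comb R k) \<le> 2 / R + (if norm (\<xi> - comb R k) < R / 2 then 1 else 0)" for k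
    proof -
      let ?y = "norm (\<xi> - comb R k)"
      have 1: "1 + ?y \<le> (1 + ?y) ^ ?M" by (rule self_le_power) auto
      show ?thesis
      proof (cases "?y < R / 2")
        case True
        have "1 \<le> (1 + ?y) ^ ?M" using 1 norm_ge_zero[of "\<xi> - comb R k"] by linarith
        then have "?w (\<xi> - comb R k) \<le> 1" by (subst divide_le_eq_1_pos) linarith+
        then show ?thesis using True R(1) by (auto intro: order_trans)
      next
        case False
        then have "R / 2 \<le> (1 + ?y) ^ ?M" using 1 by linarith
        then have "?w (\<xi> - comb R k) \<le> 1 / (R / 2)"
          using R(1) by (intro divide_left_mono mult_pos_pos) auto
        then show ?thesis using False by simp
      qed
    qed
    then have "G \<xi> \<le> (\<Sum>k<N. 2 / R + (if norm (\<xi> - comb R k) < R / 2 then 1 else 0))"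
      unfolding G_def by (intro sum_mono)
    also have "\<dots> = real N * (2 / R) + real (card ?near)"
      by (simp add: sum.distrib sum.If_cases) (simp add: Int_def)
    also have "card ?near \<le> 1"
    proof -
      have "k = l" if "k \<in> ?near" "l \<in> ?near" for k l
      proof (rule ccontr)
        assume "k \<noteq> l"
        then have "R \<le> norm (comb R k - comb R l :: real^'n)"
          using R(1) by (intro norm_comb_diff_ge) auto
        also have "\<dots> \<le> norm (\<xi> - comb R l) + norm (\<xi> - comb R k)"
          using norm_triangle_ineq4[of "\<xi> - comb R l" "\<xi> - comb R k"] by simp
        finally show False using that by auto
      qed
      then show ?thesis using card_le_Suc0_iff_eq[of ?near] by auto
    qed
    also have "real N * (2 / R) \<le> 2" using R by (simp add: divide_simps)
    finally show ?thesis by simp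
  qed
  have V: "norm (stft \<gamma> (\<lambda>t. (\<Sum>k<N. c k * cis (comb R k \<bullet> t)) * \<gamma> t) x \<xi>) \<le> K * s * G \<xi> * ?w x" for x \<xi>
  proof -
    have "norm (\<Sum>k<N. c k * stft \<gamma> \<gamma> x (\<xi> - comb R k)) \<le> (\<Sum>k<N. s * (K * (?w x * ?w (\<xi> - comb R k))))"
    proof (rule sum_norm_le)
      fix k
      have "norm (stft \<gamma> \<gamma> x (\<xi> - comb R k)) \<le> K * (?w x * ?w (\<xi> - comb R k))"
      proof -
        have "K * (1 / A * (1 / B)) = K / (A * B)" for A B :: real by simp
        then show ?thesis using K(2)[of x "\<xi> - comb R k"] by (simp only:)
      qed
      then show "norm (c k * stft \<gamma> \<gamma> x (\<xi> - comb R k)) \<le> s * (K * (?w x * ?w (\<xi> - comb R k)))"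
        unfolding norm_mult by (intro mult_mono c s) auto
    qed
    also have "\<dots> = K * s * G \<xi> * ?w x"
      unfolding G_def sum_distrib_left sum_distrib_right by (intro sum.cong refl) (simp only: mult_ac)
    finally show ?thesis by (simp only: stft_modulations[OF \<gamma>])
  qed
  have "(\<integral>\<^sup>+ \<xi>. ennreal (G \<xi> powr q) \<partial>lborel) \<le> (\<integral>\<^sup>+ \<xi>. (\<Sum>k<N. ennreal (3 powr (q - 1) * ?w (\<xi> - comb R k))) \<partial>lborel)"
  proof (rule nn_integral_mono)
    fix \<xi>
    have "G \<xi> powr q = G \<xi> powr (q - 1) * G \<xi>"
      using G0[of \<xi>] powr_add[of "G \<xi>" "q - 1" 1] by (cases "G \<xi> = 0") auto
    also have "\<dots> \<le> 3 powr (q - 1) * G \<xi>"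
      using G0 G3 pq by (intro mult_right_mono powr_mono2) auto
    finally have "ennreal (G \<xi> powr q) \<le> ennreal (\<Sum>k<N. 3 powr (q - 1) * ?w (\<xi> - comb R k))"
      unfolding G_def sum_distrib_left by (rule ennreal_leI)
    also have "\<dots> = (\<Sum>k<N. ennreal (3 powr (q - 1) * ?w (\<xi> - comb R k)))"
      by (intro sum_ennreal[symmetric] mult_nonneg_nonneg w) simp
    finally show "ennreal (G \<xi> powr q) \<le> (\<Sum>k<N. ennreal (3 powr (q - 1) * ?w (\<xi> - comb R k)))" .
  qed
  also have "\<dots> = (\<Sum>k<N. \<integral>\<^sup>+ \<xi>. ennreal (3 powr (q - 1) * ?w (\<xi> - comb R k)) \<partial>lborel)"
    using wMk by (intro nn_integral_sum) (intro measurable_ennreal[THEN measurable_compose[rotated]] borel_measurable_times borel_measurable_const; simp)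
  also have "\<dots> = (\<Sum>k<N. ennreal (3 powr (q - 1) * lborel_weight TYPE('n)))"
  proof (rule sum.cong[OF refl])
    fix k
    have "(\<integral>\<^sup>+ \<xi>. ennreal (3 powr (q - 1) * ?w (\<xi> - comb R k)) \<partial>lborel) = (\<integral>\<^sup>+ \<xi>. ennreal (3 powr (q - 1) * ?w \<xi>) \<partial>lborel)"
      using wM by (intro nn_integral_lborel_translate[of "\<lambda>\<xi>. ennreal (3 powr (q - 1) * ?w \<xi>)"])
         (intro measurable_ennreal[THEN measurable_compose[rotated]] borel_measurable_times borel_measurable_const; simp)
    then show "(\<integral>\<^sup>+ \<xi>. ennreal (3 powr (q - 1) * ?w (\<xi> - comb R k)) \<partial>lborel) = ennreal (3 powr (q - 1) * lborel_weight TYPE('n))"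
      using nn_integral_weight[where 'n = 'n, of "3 powr (q - 1)"] by simp
  qed
  also have "\<dots> = ennreal (3 powr (q - 1) * (real N * lborel_weight TYPE('n)))"
    using lborel_weight_nonneg[where 'n = 'n]
    by (simp add: ennreal_of_nat_eq_real_of_nat ennreal_mult[symmetric] mult_ac)
  finally have int: "(\<integral>\<^sup>+ \<xi>. ennreal (G \<xi> powr q) \<partial>lborel) \<le> \<dots>" .
  have "mixed p q (stft \<gamma> (\<lambda>t. (\<Sum>k<N. c k * cis (comb R k \<bullet> t)) * \<gamma> t))
    \<le> ennreal ((K * s) powr q * lborel_weight TYPE('n) powr (q / p)) * (\<integral>\<^sup>+ \<xi>. ennreal (G \<xi> powr q) \<partial>lborel)"
    using pq K(1) s by (intro mixed_le V G0 GM) auto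
  also have "\<dots> \<le> ennreal ((K * s) powr q * lborel_weight TYPE('n) powr (q / p)) * ennreal (3 powr (q - 1) * (real N * lborel_weight TYPE('n)))"
    by (intro mult_left_mono int) simp
  finally show ?thesis
    using lborel_weight_nonneg[where 'n = 'n] by (simp add: ennreal_mult[symmetric])
qed

text \<open>Near each comb point a single term dominates. Since R \<ge> 2 and \<delta> \<le> 1, the
  balls around the comb points are disjoint, and their measures add up to N times one
  volume.\<close>

lemma mixed_comb_ge:
  fixes \<gamma> :: "real^'n::finite \<Rightarrow> complex"
  assumes pq: "0 < p" "0 < q" and \<gamma>: "schwartz \<gamma>"
    and K: "0 < K" "\<And>x \<xi>. norm (stft \<gamma> \<gamma> x \<xi>) \<le> K / (1 + norm \<xi>)"
    and \<delta>: "\<delta> \<le> 1" and b: "0 < b" "\<And>x \<xi>. norm x < \<delta> \<Longrightarrow> norm \<xi> < \<delta> \<Longrightarrow> 2 * b \<le> norm (stft \<gamma> \<gamma> x \<xi>)"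
    and R: "2 \<le> R" "real N * K / b \<le> R" and c: "\<And>k. norm (c k) = s"
  shows "ennreal ((b * s) powr q * measure lborel (ball (0::real^'n) \<delta>) powr (q / p) * (real N * measure lborel (ball (0::real^'n) \<delta>)))
    \<le> mixed p q (stft \<gamma> (\<lambda>t. (\<Sum>k<N. c k * cis (comb R k \<bullet> t)) * \<gamma> t))"
proof -
  let ?v = "measure lborel (ball (0::real^'n) \<delta>)"
  let ?B = "\<lambda>k. ball (comb R k :: real^'n) \<delta>"
  let ?E = "\<Union>k<N. ?B k"
  have s: "0 \<le> s" using norm_ge_zero[of "c 0"] by (simp only: c)
  \<comment> \<open>The spacing condition keeps the joint tail of all frequencies below b * s, half
    of the lower bound 2 * b * s for the main term.\<close>
  have NK: "real N * s * (K / R) \<le> b * s"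
  proof -
    have "real N * (K / R) \<le> b" using R b(1) by (simp add: divide_simps mult.commute)
    from mult_left_mono[OF this s] show ?thesis by (simp only: mult_ac)
  qed
  have vB: "emeasure lborel (?B k) = ennreal ?v" for k
  proof -
    have "emeasure lborel (ball 0 \<delta> :: (real^'n) set) = ennreal ?v"
      using emeasure_bounded_finite[OF bounded_ball[of "0::real^'n" \<delta>]] by (intro emeasure_eq_ennreal_measure) auto
    moreover have "emeasure lborel (?B k) = emeasure lborel (ball 0 \<delta> :: (real^'n) set)"
      by (cases "0 \<le> \<delta>") (auto simp: emeasure_ball ball_empty)
    ultimately show ?thesis by simp
  qed
  have "disjoint_family_on ?B {..<N}"
    unfolding disjoint_family_on_def
  proof (intro ballI impI)
    fix k l :: nat assume "k \<noteq> l"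
    then have "2 \<le> dist (comb R k :: real^'n) (comb R l)"
      using R(1) norm_comb_diff_ge[of R k l, where 'n = 'n] by (simp add: dist_norm)
    then show "?B k \<inter> ?B l = {}"
      using \<delta> by (intro disjoint_ballI) simp
  qed
  then have "emeasure lborel ?E = (\<Sum>k<N. emeasure lborel (?B k))"
    by (intro sum_emeasure[symmetric]) auto
  then have E: "emeasure lborel ?E = ennreal (real N * ?v)"
    by (simp add: vB ennreal_mult ennreal_of_nat_eq_real_of_nat)
  have "b * s \<le> norm (stft \<gamma> (\<lambda>t. (\<Sum>k<N. c k * cis (comb R k \<bullet> t)) * \<gamma> t) x \<xi>)"
    if x: "norm x < \<delta>" and \<xi>: "\<xi> \<in> ?E" for x \<xi>
  proof -
    obtain k where k: "k < N" "norm (\<xi> - comb R k) < \<delta>"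
      using \<xi> by (auto simp: dist_norm norm_minus_commute)
    have "{j \<in> {..<N}. (comb R j :: real^'n) = comb R k} = {k}"
      using k R(1) by (auto simp: comb_eq_iff)
    then show ?thesis
      using R(1) b(1) NK c k \<gamma> K \<delta> b x
      by (intro stft_modulations_lower_bound[where a = "comb R" and \<omega> = "comb R k" and R = R and K = K and \<delta> = \<delta>])
         (auto intro!: norm_comb_diff_ge)
  qed
  then have "ennreal ((b * s) powr q * ?v powr (q / p)) * emeasure lborel ?E
    \<le> mixed p q (stft \<gamma> (\<lambda>t. (\<Sum>k<N. c k * cis (comb R k \<bullet> t)) * \<gamma> t))"
    using pq b(1) s by (intro mixed_ge) auto
  then show ?thesis
    unfolding E by (simp add: ennreal_mult[symmetric])
qed

text \<open>Nonzero differences in an arithmetic progression repeat, and their coefficients may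
  cancel. Only the ball around frequency 0 is used, where the diagonal terms add without
  cancellation.\<close>

lemma mixed_comb_square_ge:
  fixes \<gamma> :: "real^'n::finite \<Rightarrow> complex"
  assumes pq: "0 < p" "0 < q" and \<gamma>: "schwartz \<gamma>"
    and K: "0 < K" "\<And>x \<xi>. norm (stft \<gamma> \<gamma> x \<xi>) \<le> K / (1 + norm \<xi>)"
    and \<delta>: "\<delta> \<le> 1" and b: "0 < b" "\<And>x \<xi>. norm x < \<delta> \<Longrightarrow> norm \<xi> < \<delta> \<Longrightarrow> 2 * b \<le> norm (stft \<gamma> \<gamma> x \<xi>)"
    and R: "2 \<le> R" "real N * K / b \<le> R" and c: "\<And>k. norm (c k) = s" and s: "real N * s\<^sup>2 = 1 / 2"
  shows "ennreal ((b / 2) powr q * measure lborel (ball (0::real^'n) \<delta>) powr (q / p) * measure lborel (ball (0::real^'n) \<delta>))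
    \<le> mixed p q (stft \<gamma> (\<lambda>t. cnj (\<Sum>k<N. c k * cis (comb R k \<bullet> t)) * ((\<Sum>k<N. c k * cis (comb R k \<bullet> t)) * \<gamma> t)))"
proof -
  let ?v = "measure lborel (ball (0::real^'n) \<delta>)"
  let ?J = "{..<N} \<times> {..<N}"
  let ?a = "\<lambda>j. comb R (fst j) - comb R (snd j) :: real^'n" and ?c = "\<lambda>j. c (fst j) * cnj (c (snd j))"
  let ?P = "\<lambda>t. \<Sum>k<N. c k * cis (comb R k \<bullet> t)"
  have expand: "cnj (?P t) * (?P t * \<gamma> t) = (\<Sum>j\<in>?J. ?c j * cis (?a j \<bullet> t)) * \<gamma> t" for t
  proof -
    have "?P t * cnj (?P t) = (\<Sum>k<N. \<Sum>l<N. (c k * cis (comb R k \<bullet> t)) * (cnj (c l * cis (comb R l \<bullet> t))))"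
      by (simp only: cnj_sum sum_product)
    also have "\<dots> = (\<Sum>j\<in>?J. (c (fst j) * cis (comb R (fst j) \<bullet> t)) * (cnj (c (snd j) * cis (comb R (snd j) \<bullet> t))))"
      by (simp only: sum.cartesian_product split_beta')
    also have "\<dots> = (\<Sum>j\<in>?J. ?c j * cis (?a j \<bullet> t))"
    proof (rule sum.cong[OF refl])
      fix j
      have "cis (?a j \<bullet> t) = cis (comb R (fst j) \<bullet> t) * cnj (cis (comb R (snd j) \<bullet> t))"
        by (simp add: cis_cnj cis_mult inner_diff_left)
      then show "(c (fst j) * cis (comb R (fst j) \<bullet> t)) * (cnj (c (snd j) * cis (comb R (snd j) \<bullet> t))) = ?c j * cis (?a j \<bullet> t)"
        by (simp only: complex_cnj_mult mult_ac)
    qed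
    finally show ?thesis by (simp only: mult_ac)
  qed
  have diag: "{j \<in> ?J. ?a j = 0} = (\<lambda>k. (k, k)) ` {..<N}"
    using R(1) by (auto simp: comb_eq_iff)
  have "(\<Sum>j\<in>{j \<in> ?J. ?a j = 0}. ?c j) = (\<Sum>k<N. c k * cnj (c k))"
    unfolding diag by (subst sum.reindex) (auto simp: inj_on_def)
  also have "\<dots> = of_real (real N * s\<^sup>2)"
    by (simp add: complex_norm_square[symmetric] c)
  finally have half: "1 / 2 \<le> norm (\<Sum>j\<in>{j \<in> ?J. ?a j = 0}. ?c j)"
    by (simp only: s norm_of_real)
  \<comment> \<open>There are N^2 pairs, but their coefficients have total modulus N^2 s^2 = N / 2.
    Hence the spacing needed for N frequencies also handles the product.\<close>
  have total: "(\<Sum>j\<in>?J. norm (?c j)) = real N * (real N * s\<^sup>2)"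
    by (simp add: norm_mult c power2_eq_square)
  have "(\<Sum>j\<in>?J. norm (?c j)) * (K / R) \<le> b * (1 / 2)"
    unfolding total s using R b(1) by (simp add: divide_simps mult.commute)
  then have "b * (1 / 2) \<le> norm (stft \<gamma> (\<lambda>t. (\<Sum>j\<in>?J. ?c j * cis (?a j \<bullet> t)) * \<gamma> t) x \<xi>)"
    if "norm x < \<delta>" "\<xi> \<in> ball 0 \<delta>" for x \<xi>
    using that half R(1) K \<delta> b(1)
    by (intro stft_modulations_lower_bound[OF \<gamma> _ K \<delta> b(2), where a = ?a and \<omega> = 0 and R = R])
       (auto intro!: norm_comb_diff_ge)
  then have "ennreal ((b * (1 / 2)) powr q * ?v powr (q / p)) * emeasure lborel (ball (0::real^'n) \<delta>)
    \<le> mixed p q (stft \<gamma> (\<lambda>t. (\<Sum>j\<in>?J. ?c j * cis (?a j \<bullet> t)) * \<gamma> t))"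
    using pq b(1) by (intro mixed_ge) auto
  moreover have "emeasure lborel (ball (0::real^'n) \<delta>) = ennreal ?v"
    using emeasure_bounded_finite[OF bounded_ball[of "0::real^'n" \<delta>]] by (intro emeasure_eq_ennreal_measure) auto
  ultimately show ?thesis
    unfolding expand by (simp add: ennreal_mult[symmetric])
qed

section \<open>Choice of the parameters and conclusion\<close>

lemma exists_powr_greater:
  fixes B C s :: real
  assumes "0 < B" "0 < s" shows "\<exists>j. C < B * (2 * 2 ^ j) powr s"
proof -
  obtain j where j: "C / B < (2 powr s) ^ j"
    using real_arch_pow[of "2 powr s" "C / B"] assms by auto
  have "C < B * (2 powr s) ^ j" using j assms by (simp add: divide_simps mult.commute)
  also have "(2 powr s) ^ j = (2 ^ j) powr s" by (simp add: powr_realpow[symmetric] powr_powr mult.commute)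
  also have "\<dots> \<le> (2 * 2 ^ j) powr s" using assms by (intro powr_mono2) auto
  finally show ?thesis using assms by (auto simp: mult_left_mono)
qed

lemma unbounded_multipliers:
  fixes \<gamma> :: "real^'n::finite \<Rightarrow> complex"
  assumes p: "1 < p" and q: "1 < q" "q \<noteq> 2" and \<gamma>: "schwartz \<gamma>" "\<gamma> \<noteq> (\<lambda>_. 0)"
  obtains mm :: "nat \<Rightarrow> real^'n \<Rightarrow> complex" where "\<And>j. mm j \<in> borel_measurable borel" "\<And>j x. norm (mm j x) \<le> 1"
    "\<And>C. \<exists>j f. schwartz f \<and> \<not> mixed p q (stft \<gamma> (\<lambda>x. mm j x * f x)) \<le> ennreal C * mixed p q (stft \<gamma> f)"
proof -
  let ?M = "CARD('n) + 2" and ?I = "lborel_weight TYPE('n)"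
  obtain K where K: "0 < K" "\<And>x \<xi>. norm (stft \<gamma> \<gamma> x \<xi>) \<le> K / ((1 + norm x) ^ ?M * (1 + norm \<xi>) ^ ?M)"
    using stft_decay[OF \<gamma>(1) \<gamma>(1), of ?M ?M] by metis
  have K1: "norm (stft \<gamma> \<gamma> x \<xi>) \<le> K / (1 + norm \<xi>)" for x \<xi>
  proof -
    have "1 * (1 + norm \<xi>) \<le> (1 + norm x) ^ ?M * (1 + norm \<xi>) ^ ?M"
      by (intro mult_mono one_le_power self_le_power) auto
    then have "K / ((1 + norm x) ^ ?M * (1 + norm \<xi>) ^ ?M) \<le> K / (1 + norm \<xi>)"
      using K(1) by (intro divide_left_mono mult_pos_pos zero_less_power) (auto intro: add_pos_nonneg)
    then show ?thesis using K(2)[of x \<xi>] by linarith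
  qed
  obtain b \<delta> where b\<delta>: "0 < b" "0 < \<delta>" "\<delta> \<le> 1"
    and b: "\<And>x \<xi>. norm x < \<delta> \<Longrightarrow> norm \<xi> < \<delta> \<Longrightarrow> 2 * b \<le> norm (stft \<gamma> \<gamma> x \<xi>)"
    using stft_self_lower_bound[OF \<gamma>] by metis
  define v where "v = measure lborel (ball (0::real^'n) \<delta>)"
  have v: "0 < v" unfolding v_def using content_ball_pos[OF b\<delta>(2), of "0::real^'n"] by simp
  obtain \<epsilon> :: "nat \<Rightarrow> nat \<Rightarrow> real" where \<epsilon>: "\<And>j k. \<bar>\<epsilon> j k\<bar> = 1"
    "\<And>j \<theta>. norm (\<Sum>k<2^j. of_real (\<epsilon> j k) * cis (real k * \<theta>)) \<le> sqrt (2 * 2 ^ j)"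
  proof -
    have "\<exists>\<epsilon>::nat \<Rightarrow> real. (\<forall>k. \<bar>\<epsilon> k\<bar> = 1) \<and> (\<forall>\<theta>. norm (\<Sum>k<2^j. of_real (\<epsilon> k) * cis (real k * \<theta>)) \<le> sqrt (2 * 2 ^ j))" for j
      using rudin_shapiro_cis[of j] by metis
    then obtain \<epsilon> :: "nat \<Rightarrow> nat \<Rightarrow> real" where "\<And>j. (\<forall>k. \<bar>\<epsilon> j k\<bar> = 1) \<and> (\<forall>\<theta>. norm (\<Sum>k<2^j. of_real (\<epsilon> j k) * cis (real k * \<theta>)) \<le> sqrt (2 * 2 ^ j))"
      by metis
    then show thesis using that[of \<epsilon>] by blast
  qed
  \<comment> \<open>X j = 2 N is the square of the Rudin-Shapiro bound, so coefficients of size s j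
    = 1 / sqrt (X j) give a multiplier bounded by 1. The quantity N s^q then equals half of X^(1 - q
    / 2).\<close>
  define X where "X j = (2 * 2 ^ j :: real)" for j :: nat
  have X: "0 < X j" for j by (simp add: X_def)
  define s where "s j = 1 / sqrt (X j)" for j
  have s: "0 < s j" "s j powr q = X j powr (- q / 2)" "(s j)\<^sup>2 = 1 / X j" for j
  proof -
    have "s j = X j powr (- 1 / 2)"
      using X[of j] by (simp add: s_def powr_half_sqrt[symmetric] powr_minus_divide)
    then show "s j powr q = X j powr (- q / 2)" by (simp add: powr_powr)
  qed (use X[of j] in \<open>auto simp: s_def power_divide\<close>)
  \<comment> \<open>The three lower bounds separate the balls, keep the sum of the weights bounded,
    and make the tails small compared with b.\<close>
  define R where "R j = max (max 2 (2 ^ j)) (2 ^ j * K / b)" for j :: nat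
  have R: "2 \<le> R j" "0 < R j" "real (2 ^ j) \<le> R j" "real (2 ^ j) * K / b \<le> R j" for j
    by (auto simp: R_def)
  define c where "c j k = complex_of_real (\<epsilon> j k * s j)" for j k
  have c: "norm (c j k) = s j" for j k
    using s(1)[of j] by (simp add: c_def norm_mult \<epsilon>)
  define P where "P j t = (\<Sum>k<2^j. c j k * cis (comb (R j) k \<bullet> t))" for j and t :: "real^'n"
  have P_meas: "P j \<in> borel_measurable borel" for j
    unfolding P_def by measurable
  have P1: "norm (P j t) \<le> 1" for j t
  proof -
    let ?\<theta> = "R j * (axis undefined 1 \<bullet> t)"
    have "P j t = of_real (s j) * (\<Sum>k<2^j. of_real (\<epsilon> j k) * cis (real k * ?\<theta>))"
      unfolding P_def c_def comb_def sum_distrib_left by (intro sum.cong refl) (simp add: mult_ac)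
    then have "norm (P j t) \<le> s j * sqrt (X j)"
      using \<epsilon>(2)[of j ?\<theta>] s(1)[of j] by (simp add: norm_mult X_def)
    then show ?thesis using X[of j] by (simp add: s_def)
  qed
  have schwartz_P: "schwartz (\<lambda>t. P j t * \<gamma> t)" for j
    unfolding P_def by (intro schwartz_modulations \<gamma>) simp
  note upper = mixed_comb_le[OF less_imp_le[OF p] less_imp_le[OF q(1)] \<gamma>(1) less_imp_le[OF K(1)] K(2)]
  have pq0: "0 < p" "0 < q" using p q by auto
  define D where "D = K powr q * ?I powr (q / p) * (3 powr (q - 1) * ?I)"
  have D: "0 \<le> D" unfolding D_def by (intro mult_nonneg_nonneg lborel_weight_nonneg) auto
  consider "q < 2" | "2 < q" using q(2) by linarith
  then show thesis
  proof cases
    case 1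
    show thesis
    proof (rule that[of P, OF P_meas P1])
      fix C :: real
      \<comment> \<open>The window itself is a comb with one term, of frequency 0 and coefficient
        1.\<close>
      have "mixed p q (stft \<gamma> \<gamma>) \<le> ennreal D"
        using upper[of 2 1 "\<lambda>_. 1" 1] by (simp add: D_def comb_def)
      then have "ennreal C * mixed p q (stft \<gamma> \<gamma>) \<le> ennreal (max 0 C) * ennreal D"
        by (intro mult_mono ennreal_leI) auto
      then have CD: "ennreal C * mixed p q (stft \<gamma> \<gamma>) \<le> ennreal (max 0 C * D)"
        using D by (simp add: ennreal_mult)
      \<comment> \<open>The division by 2 accounts for N = X j / 2.\<close>
      define B where "B = b powr q * v powr (q / p) * v / 2"
      have "0 < B" using b\<delta>(1) v by (simp add: B_def)
      then obtain j where j: "max 0 C * D < B * X j powr (1 - q / 2)"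
        using exists_powr_greater[of B "1 - q / 2" "max 0 C * D"] 1 by (auto simp: X_def)
      have "ennreal (B * X j powr (1 - q / 2)) = ennreal ((b * s j) powr q * v powr (q / p) * (real (2 ^ j) * v))"
      proof -
        have "X j powr (1 - q / 2) = X j * s j powr q"
          using X[of j] powr_add[of "X j" 1 "- q / 2"] by (simp add: s(2))
        moreover have "(b * s j) powr q = b powr q * s j powr q" by (rule powr_mult)
        ultimately show ?thesis by (simp add: B_def X_def mult_ac)
      qed
      also have "\<dots> \<le> mixed p q (stft \<gamma> (\<lambda>x. P j x * \<gamma> x))"
        unfolding v_def P_def
        by (rule mixed_comb_ge[OF pq0 \<gamma>(1) K(1) K1 b\<delta>(3) b\<delta>(1) b R(1) R(4) c])
      finally have low: "ennreal (B * X j powr (1 - q / 2)) \<le> mixed p q (stft \<gamma> (\<lambda>x. P j x * \<gamma> x))" .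
      have "0 \<le> max 0 C * D" using D by (intro mult_nonneg_nonneg) auto
      then have "ennreal (max 0 C * D) < ennreal (B * X j powr (1 - q / 2))"
        using j by (intro ennreal_lessI) linarith+
      then have "ennreal (max 0 C * D) < mixed p q (stft \<gamma> (\<lambda>x. P j x * \<gamma> x))"
        using low by (rule less_le_trans)
      then show "\<exists>j f. schwartz f \<and> \<not> mixed p q (stft \<gamma> (\<lambda>x. P j x * f x)) \<le> ennreal C * mixed p q (stft \<gamma> f)"
        using CD \<gamma>(1) by (intro exI[of _ j] exI[of _ \<gamma>] conjI notI) (auto dest!: order_trans)
    qed
  next
    case 2
    show thesis
    proof (rule that[of "\<lambda>j t. cnj (P j t)"])
      fix C :: real
      define L where "L = (b / 2) powr q * v powr (q / p) * v"
      have L: "0 < L" using b\<delta>(1) v by (simp add: L_def)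
      \<comment> \<open>The exponent is the negative of the one in the bound for the input, so
        multiplying by X^(1 - q / 2) turns this growth into smallness of the input relative to
        L.\<close>
      obtain j where j: "max 0 C * (D / 2) < L * X j powr (q / 2 - 1)"
        using exists_powr_greater[of L "q / 2 - 1" "max 0 C * (D / 2)"] L 2 by (auto simp: X_def)
      have "mixed p q (stft \<gamma> (\<lambda>x. P j x * \<gamma> x)) \<le> ennreal ((K * s j) powr q * ?I powr (q / p) * (3 powr (q - 1) * (real (2 ^ j) * ?I)))"
        unfolding P_def by (rule upper[OF R(2) R(3)]) (simp add: c)
      also have "(K * s j) powr q * ?I powr (q / p) * (3 powr (q - 1) * (real (2 ^ j) * ?I)) = D / 2 * X j powr (1 - q / 2)"
      proof -
        have "X j powr (1 - q / 2) = X j * s j powr q"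
          using X[of j] powr_add[of "X j" 1 "- q / 2"] by (simp add: s(2))
        moreover have "(K * s j) powr q = K powr q * s j powr q" by (rule powr_mult)
        ultimately show ?thesis by (simp add: D_def X_def mult_ac)
      qed
      finally have "ennreal C * mixed p q (stft \<gamma> (\<lambda>x. P j x * \<gamma> x)) \<le> ennreal (max 0 C) * ennreal (D / 2 * X j powr (1 - q / 2))"
        by (intro mult_mono ennreal_leI) auto
      also have "\<dots> = ennreal (max 0 C * (D / 2) * X j powr (1 - q / 2))"
        using D by (simp add: ennreal_mult[symmetric] mult.assoc)
      also have "\<dots> < ennreal L"
      proof (rule ennreal_lessI[OF L])
        have "max 0 C * (D / 2) * X j powr (1 - q / 2) < L * X j powr (q / 2 - 1) * X j powr (1 - q / 2)"
          using j X[of j] by (intro mult_strict_right_mono) auto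
        also have "\<dots> = L"
          using X[of j] by (simp add: mult.assoc powr_add[symmetric])
        finally show "max 0 C * (D / 2) * X j powr (1 - q / 2) < L" .
      qed
      also have "\<dots> \<le> mixed p q (stft \<gamma> (\<lambda>x. cnj (P j x) * (P j x * \<gamma> x)))"
      proof -
        have half: "real (2 ^ j) * (s j)\<^sup>2 = 1 / 2" unfolding s(3) by (simp add: X_def)
        show ?thesis
          unfolding L_def v_def P_def
          by (rule mixed_comb_square_ge[OF pq0 \<gamma>(1) K(1) K1 b\<delta>(3) b\<delta>(1) b R(1) R(4) c half])
      qed
      finally show "\<exists>j f. schwartz f \<and> \<not> mixed p q (stft \<gamma> (\<lambda>x. cnj (P j x) * f x)) \<le> ennreal C * mixed p q (stft \<gamma> f)"
        using schwartz_P[of j] by (intro exI[of _ j] exI[of _ "\<lambda>x. P j x * \<gamma> x"]) (simp add: not_le)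
    next
      show "(\<lambda>t. cnj (P j t)) \<in> borel_measurable borel" for j
        using P_meas[of j] by measurable
    qed (simp add: P1)
  qed
qed

theorem theorem1p2:
  fixes p q :: real and \<gamma> :: "real^'n::finite \<Rightarrow> complex"
  assumes "1 < p" and "1 < q" and "q \<noteq> 2"
    and "schwartz \<gamma>" and "\<gamma> \<noteq> (\<lambda>_. 0)"
  shows "\<exists>T K. CZO T K \<and>
           \<not> (\<exists>C::real. \<forall>f. schwartz f \<longrightarrow>
                 mod_norm p q \<gamma> (T f) \<le> ennreal C * mod_norm p q \<gamma> f)"
proof -
  have pq: "0 < p" "0 < q" using assms by auto
  obtain mm :: "nat \<Rightarrow> real^'n \<Rightarrow> complex" where mm: "\<And>j. mm j \<in> borel_measurable borel" "\<And>j x. norm (mm j x) \<le> 1"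
    and unbdd: "\<And>C. \<exists>j f. schwartz f \<and> \<not> mixed p q (stft \<gamma> (\<lambda>x. mm j x * f x)) \<le> ennreal C * mixed p q (stft \<gamma> f)"
    using unbounded_multipliers[OF assms] by blast
  obtain m :: "real^'n \<Rightarrow> complex" where m: "m \<in> borel_measurable borel" "\<And>x. norm (m x) \<le> 1"
    and glue: "\<forall>C j f. schwartz f \<longrightarrow>
      (\<forall>g. schwartz g \<longrightarrow> mixed p q (stft \<gamma> (\<lambda>x. m x * g x)) \<le> C * mixed p q (stft \<gamma> g)) \<longrightarrow>
      mixed p q (stft \<gamma> (\<lambda>x. mm j x * f x)) \<le> C * mixed p q (stft \<gamma> f)"
    by (rule gluing[where mm = mm, OF pq assms(4) mm]) (rule that)
  have "\<not> (\<forall>f. schwartz f \<longrightarrow> mod_norm p q \<gamma> (\<lambda>x. m x * f x) \<le> ennreal C * mod_norm p q \<gamma> f)" for C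
  proof
    assume "\<forall>f. schwartz f \<longrightarrow> mod_norm p q \<gamma> (\<lambda>x. m x * f x) \<le> ennreal C * mod_norm p q \<gamma> f"
    then have "\<forall>g. schwartz g \<longrightarrow>
        mixed p q (stft \<gamma> (\<lambda>x. m x * g x)) \<le> ennreal (max 0 C powr q) * mixed p q (stft \<gamma> g)"
      by (intro allI impI mixed_le_of_mod_norm_le[OF pq(2)]) blast
    \<comment> \<open>The constant transferred by \<open>glue\<close> does not depend on j, which
      contradicts the choice of the family \<open>mm\<close>.\<close>
    with glue have "\<forall>j f. schwartz f \<longrightarrow>
        mixed p q (stft \<gamma> (\<lambda>x. mm j x * f x)) \<le> ennreal (max 0 C powr q) * mixed p q (stft \<gamma> f)"
      by blast
    moreover obtain j f where "schwartz f"
      "\<not> mixed p q (stft \<gamma> (\<lambda>x. mm j x * f x)) \<le> ennreal (max 0 C powr q) * mixed p q (stft \<gamma> f)"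
      using unbdd by blast
    ultimately show False by blast
  qed
  with CZO_multiplication[OF m] show ?thesis by blast
qed

end
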